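(* Let $\mathcal{E}$ be an error basis on $\mathfrak{H}=\mathbb{C}^q$, let $M_1,M_2$ be Hermitian operators on $\mathfrak{H}^{\otimes n}$, and let $J\subseteq\{1,\dots,n\}$ be a subset of size $m$. Then the homogeneous tensor enumerators satisfy $$\mathbf{B}^{(J)}(w,z;M_1,M_2)=\Psi\left[\mathbf{A}^{(J)}\left(\tfrac{w+(q^2-1)z}{q},\tfrac{w-z}{q};M_1,M_2\right)\right],$$ where $\Psi$ is the linear map (extended linearly over polynomials in $w,z$) with $\Psi(e_{E,E'})=\frac{1}{q^{2m}}\sum_{F,F'\in\mathcal{E}^m}\operatorname{Tr}(F^\dagger E F'(E')^\dagger)\,e_{F,F'}$ for $E,E'\in\mathcal{E}^m$.
   Context: An error basis on $\mathfrak{H}=\mathbb{C}^q$ is a set $\mathcal{E}$ of unitary operators containing $I$ that is a basis of $L(\mathfrak{H})$ (so $|\mathcal{E}|=q^2$), with $\operatorname{Tr}(EF^\dagger)=0$ for $E\neq F$, and such that $EF=\omega(E,F)FE$ for all $E,F\in\mathcal{E}$, with scalars $\omega(E,F)\in\mathbb{C}$ satisfying $\omega(E,F)^r=1$ for some fixed $r$. Put $\mathcal{E}^n=\{E_1\otimes\cdots\otimes E_n: E_i\in\mathcal{E}\}$; the weight $\mathrm{wt}(E_1\otimes\cdots\otimes E_n)$ is the number of $i$ with $E_i\ne I$. For $J=\{j_1<\dots<j_m\}\subseteq\{1,\dots,n\}$, $E\in\mathcal{E}^m$, $F\in\mathcal{E}^{n-m}$, the operator $E\otimes_J F\in\mathcal{E}^n$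 has $E_k$ as its $j_k$-th tensor factor ($k=1,\dots,m$) and the factors of $F$, in order, in the remaining positions. Let $V$ be the vector space over $\mathbb{C}$ with formal basis $\{e_{E,E'}:E,E'\in\mathcal{E}\}$; for $E,E'\in\mathcal{E}^m$ write $e_{E,E'}=e_{E_1,E_1'}\otimes\cdots\otimes e_{E_m,E_m'}\in V^{\otimes m}$. The tensor enumerators are $$\mathbf{A}^{(J)}(z;M_1,M_2)=\sum_{E,E'\in\mathcal{E}^m}\sum_{F\in\mathcal{E}^{n-m}}\operatorname{Tr}((E\otimes_JF)^\dagger M_1)\operatorname{Tr}((E'\otimes_JF)M_2)\,z^{\mathrm{wt}(F)}e_{E,E'},$$ $$\mathbf{B}^{(J)}(z;M_1,M_2)=\sum_{E,E'\in\mathcal{E}^m}\sum_{F\in\mathcal{E}^{n-m}}\operatorname{Tr}((E\otimes_JF)^\dagger M_1(E'\otimes_JF)M_2)\,z^{\mathrm{wt}(F)}e_{E,E'}.$$ Their homogeneous forms are obtained by replacing $z^{d}$ by $w^{n-m-d}z^{d}$, i.e. $\mathbf{A}^{(J)}(w,z)=w^{n-m}\mathbf{A}^{(J)}(z/w)$, and likewise for $\mathbf{B}^{(J)}$. *)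

theory Defs
  imports
    "Jordan_Normal_Form.Schur_Decomposition"
    "Jordan_Normal_Form.VS_Connect"
    "HOL-Library.Poly_Mapping"
begin

text \<open>
  Operators on \<open>\<complex>\<^sup>q\<close> and on its \<open>n\<close>-th tensor power are complex matrices
  of size \<open>q \<times> q\<close> and \<open>q ^ n \<times> q ^ n\<close>; the tensor power is identified with
  \<open>\<complex>\<close>-vectors of length \<open>q ^ n\<close> by ordering multi-indices lexicographically,
  so that tensor products of operators are Kronecker products.
\<close>

definition mat_tr :: "complex mat \<Rightarrow> complex" where
  "mat_tr A = (\<Sum>i<dim_row A. A $$ (i, i))"

definition hermitian_mat :: "nat \<Rightarrow> complex mat \<Rightarrow> bool" where
  "hermitian_mat d A \<longleftrightarrow> A \<in> carrier_mat d d \<and> mat_adjoint A = A"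

definition unitary_mat :: "nat \<Rightarrow> complex mat \<Rightarrow> bool" where
  "unitary_mat d A \<longleftrightarrow> A \<in> carrier_mat d d \<and> mat_adjoint A * A = 1\<^sub>m d \<and> A * mat_adjoint A = 1\<^sub>m d"

definition kron :: "complex mat \<Rightarrow> complex mat \<Rightarrow> complex mat" where
  "kron A B = mat (dim_row A * dim_row B) (dim_col A * dim_col B)
     (\<lambda>(i, j). A $$ (i div dim_row B, j div dim_col B) * B $$ (i mod dim_row B, j mod dim_col B))"

definition tensor_op :: "complex mat list \<Rightarrow> complex mat" where
  "tensor_op Es = foldr kron Es (1\<^sub>m 1)"

definition error_basis :: "nat \<Rightarrow> complex mat set \<Rightarrow> bool" where
  "error_basis q \<E> \<longleftrightarrow>
     (\<forall>E\<in>\<E>. unitary_mat q E) \<and>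
     1\<^sub>m q \<in> \<E> \<and>
     vectorspace.basis class_ring (module_mat TYPE(complex) q q) \<E> \<and>
     (\<forall>E\<in>\<E>. \<forall>F\<in>\<E>. E \<noteq> F \<longrightarrow> mat_tr (E * mat_adjoint F) = 0) \<and>
     (\<exists>\<omega> r. r > (0::nat) \<and>
        (\<forall>E\<in>\<E>. \<forall>F\<in>\<E>. E * F = \<omega> E F \<cdot>\<^sub>m (F * E) \<and> \<omega> E F ^ r = 1))"

text \<open>
  An element of \<open>\<E>\<^sup>m\<close> is represented by the list of its tensor factors. Two elements of an
  error basis that are proportional are equal, so the factors of an operator in \<open>\<E>\<^sup>m\<close> are
  determined by the operator and \<open>tensor_op\<close> maps these lists bijectively onto \<open>\<E>\<^sup>m\<close>.
\<close>

definition error_strings :: "complex mat set \<Rightarrow> nat \<Rightarrow> complex mat list set" where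
  "error_strings \<E> m = {Es. set Es \<subseteq> \<E> \<and> length Es = m}"

definition wt :: "nat \<Rightarrow> complex mat list \<Rightarrow> nat" where
  "wt q Es = card {i. i < length Es \<and> Es ! i \<noteq> 1\<^sub>m q}"

text \<open>
  The factors of \<open>E \<otimes>\<^sub>J F\<close>. Positions run over \<open>{1..n}\<close> while list indices start at 0: a position
  \<open>k\<close> in \<open>J\<close> is \<open>j\<^sub>i\<^sub>+\<^sub>1\<close> for \<open>i\<close> the number of elements of \<open>J\<close> below \<open>k\<close>,
  and similarly for the complement of \<open>J\<close>.
\<close>

definition interleave :: "nat \<Rightarrow> nat set \<Rightarrow> complex mat list \<Rightarrow> complex mat list \<Rightarrow> complex mat list" where
  "interleave n J E F =
     map (\<lambda>k. if k \<in> J then E ! card {j\<in>J. j < k} else F ! card {j\<in>{1..n} - J. j < k}) [1..<Suc n]"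

definition tensor_at :: "nat \<Rightarrow> nat set \<Rightarrow> complex mat list \<Rightarrow> complex mat list \<Rightarrow> complex mat" where
  "tensor_at n J E F = tensor_op (interleave n J E F)"

text \<open>
  \<open>V\<close> has formal basis \<open>e\<^bsub>E,E'\<^esub>\<close>. Its \<open>m\<close>-th tensor power with scalars extended to a commutative
  ring \<open>'r\<close> is the part supported on words of length \<open>m\<close> of the free module on words of pairs
  \<open>(E, E')\<close>, with the tensor product given on basis elements by concatenation of words.
\<close>

type_synonym 'r tens = "(complex mat \<times> complex mat) list \<Rightarrow>\<^sub>0 'r"

definition scale_tens :: "'r::comm_ring_1 \<Rightarrow> 'r tens \<Rightarrow> 'r tens" where
  "scale_tens c v = Poly_Mapping.map ((*) c) v"

definition tens_mult :: "'r::comm_ring_1 tens \<Rightarrow> 'r tens \<Rightarrow> 'r tens" where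
  "tens_mult u v = (\<Sum>a\<in>Poly_Mapping.keys u. \<Sum>b\<in>Poly_Mapping.keys v.
     Poly_Mapping.single (a @ b) (Poly_Mapping.lookup u a * Poly_Mapping.lookup v b))"

definition basis_V :: "complex mat \<Rightarrow> complex mat \<Rightarrow> 'r::comm_ring_1 tens" where
  "basis_V E E' = Poly_Mapping.single [(E, E')] 1"

definition basis_tens :: "complex mat list \<Rightarrow> complex mat list \<Rightarrow> 'r::comm_ring_1 tens" where
  "basis_tens E E' = foldr tens_mult (map2 basis_V E E') (Poly_Mapping.single [] 1)"

lemma basis_tens_eq_single: "basis_tens E E' = Poly_Mapping.single (zip E E') 1"
proof -
  have "foldr tens_mult (map (\<lambda>(x, y). basis_V x y) ps) (Poly_Mapping.single [] 1)
      = (Poly_Mapping.single ps 1 :: 'r::comm_ring_1 tens)" for ps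
    by (induction ps) (auto simp: tens_mult_def basis_V_def)
  then show ?thesis by (simp add: basis_tens_def)
qed

definition enum_A :: "nat \<Rightarrow> complex mat set \<Rightarrow> nat \<Rightarrow> nat set \<Rightarrow> complex mat \<Rightarrow> complex mat
    \<Rightarrow> complex poly tens" where
  "enum_A q \<E> n J M1 M2 =
     (\<Sum>E\<in>error_strings \<E> (card J). \<Sum>E'\<in>error_strings \<E> (card J). \<Sum>F\<in>error_strings \<E> (n - card J).
        scale_tens
          (monom (mat_tr (mat_adjoint (tensor_at n J E F) * M1) * mat_tr (tensor_at n J E' F * M2)) (wt q F))
          (basis_tens E E'))"

definition enum_B :: "nat \<Rightarrow> complex mat set \<Rightarrow> nat \<Rightarrow> nat set \<Rightarrow> complex mat \<Rightarrow> complex mat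
    \<Rightarrow> complex poly tens" where
  "enum_B q \<E> n J M1 M2 =
     (\<Sum>E\<in>error_strings \<E> (card J). \<Sum>E'\<in>error_strings \<E> (card J). \<Sum>F\<in>error_strings \<E> (n - card J).
        scale_tens
          (monom (mat_tr (mat_adjoint (tensor_at n J E F) * M1 * tensor_at n J E' F * M2)) (wt q F))
          (basis_tens E E'))"

text \<open>The ring \<open>\<complex>[w,z]\<close>, as polynomials in \<open>z\<close> with coefficients in \<open>\<complex>[w]\<close>.\<close>

type_synonym bipoly = "complex poly poly"

definition const_bp :: "complex \<Rightarrow> bipoly" where "const_bp c = [:[:c:]:]"
definition var_w :: bipoly where "var_w = [:[:0, 1:]:]"
definition var_z :: bipoly where "var_z = [:0, 1:]"

text \<open>
  The homogeneous form of degree \<open>N\<close> of \<open>p\<close>, with arbitrary elements \<open>w\<close>, \<open>z\<close> of \<open>\<complex>[w,z]\<close>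
  substituted for its variables. Only used for \<open>N \<ge> degree p\<close>, so no coefficient is dropped.
\<close>

definition hom_poly :: "nat \<Rightarrow> bipoly \<Rightarrow> bipoly \<Rightarrow> complex poly \<Rightarrow> bipoly" where
  "hom_poly N w z p = (\<Sum>d\<le>N. const_bp (coeff p d) * w ^ (N - d) * z ^ d)"

definition hom_tens :: "nat \<Rightarrow> bipoly \<Rightarrow> bipoly \<Rightarrow> complex poly tens \<Rightarrow> bipoly tens" where
  "hom_tens N w z v = Poly_Mapping.map (hom_poly N w z) v"

definition hom_enum_A :: "nat \<Rightarrow> complex mat set \<Rightarrow> nat \<Rightarrow> nat set \<Rightarrow> bipoly \<Rightarrow> bipoly
    \<Rightarrow> complex mat \<Rightarrow> complex mat \<Rightarrow> bipoly tens" where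
  "hom_enum_A q \<E> n J w z M1 M2 = hom_tens (n - card J) w z (enum_A q \<E> n J M1 M2)"

definition hom_enum_B :: "nat \<Rightarrow> complex mat set \<Rightarrow> nat \<Rightarrow> nat set \<Rightarrow> bipoly \<Rightarrow> bipoly
    \<Rightarrow> complex mat \<Rightarrow> complex mat \<Rightarrow> bipoly tens" where
  "hom_enum_B q \<E> n J w z M1 M2 = hom_tens (n - card J) w z (enum_B q \<E> n J M1 M2)"

definition Psi_basis :: "nat \<Rightarrow> complex mat set \<Rightarrow> nat \<Rightarrow> complex mat list \<Rightarrow> complex mat list
    \<Rightarrow> bipoly tens" where
  "Psi_basis q \<E> m E E' =
     scale_tens (const_bp (1 / of_nat q ^ (2 * m)))
       (\<Sum>F\<in>error_strings \<E> m. \<Sum>F'\<in>error_strings \<E> m.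
          scale_tens
            (const_bp (mat_tr (mat_adjoint (tensor_op F) * tensor_op E * tensor_op F'
               * mat_adjoint (tensor_op E'))))
            (basis_tens F F'))"

definition Psi :: "nat \<Rightarrow> complex mat set \<Rightarrow> nat \<Rightarrow> bipoly tens \<Rightarrow> bipoly tens" where
  "Psi q \<E> m v = (\<Sum>ps\<in>Poly_Mapping.keys v.
     scale_tens (Poly_Mapping.lookup v ps) (Psi_basis q \<E> m (map fst ps) (map snd ps)))"

lemma lookup_scale_tens: "Poly_Mapping.lookup (scale_tens c v) k = c * Poly_Mapping.lookup v k"
  unfolding scale_tens_def by transfer (simp add: when_def)

lemma scale_tens_add_left: "scale_tens (c + d) v = scale_tens c v + scale_tens d v"
  by (rule poly_mapping_eqI) (simp add: lookup_scale_tens lookup_add algebra_simps)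

lemma scale_tens_scale_tens: "scale_tens c (scale_tens d v) = scale_tens (c * d) v"
  by (rule poly_mapping_eqI) (simp add: lookup_scale_tens mult.assoc)

lemma scale_tens_zero [simp]: "scale_tens 0 v = 0" "scale_tens c 0 = 0"
  by (rule poly_mapping_eqI, simp add: lookup_scale_tens)+

lemma scale_tens_one [simp]: "scale_tens 1 v = v"
  by (rule poly_mapping_eqI) (simp add: lookup_scale_tens)

lemma scale_tens_sum: "scale_tens c (sum f S) = (\<Sum>x\<in>S. scale_tens c (f x))"
  by (rule poly_mapping_eqI) (simp add: lookup_scale_tens lookup_sum sum_distrib_left)

lemma Psi_superset:
  assumes "finite S" "Poly_Mapping.keys v \<subseteq> S"
  shows "Psi q \<E> m v = (\<Sum>ps\<in>S.
     scale_tens (Poly_Mapping.lookup v ps) (Psi_basis q \<E> m (map fst ps) (map snd ps)))"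
  unfolding Psi_def using assms
  by (intro sum.mono_neutral_left) (auto simp: in_keys_iff)

lemma Psi_add: "Psi q \<E> m (u + v) = Psi q \<E> m u + Psi q \<E> m v"
proof -
  let ?S = "Poly_Mapping.keys u \<union> Poly_Mapping.keys v"
  have "Poly_Mapping.keys (u + v) \<subseteq> ?S" by (rule keys_add)
  then show ?thesis
    by (simp add: Psi_superset[of ?S] lookup_add scale_tens_add_left sum.distrib)
qed

lemma Psi_scale: "Psi q \<E> m (scale_tens c v) = scale_tens c (Psi q \<E> m v)"
proof -
  have "Poly_Mapping.keys (scale_tens c v) \<subseteq> Poly_Mapping.keys v"
    by (auto simp: in_keys_iff lookup_scale_tens)
  then show ?thesis
    by (simp add: Psi_superset[of "Poly_Mapping.keys v"] lookup_scale_tens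
        scale_tens_sum scale_tens_scale_tens)
qed

lemma Psi_basis_tens:
  assumes "E \<in> error_strings \<E> m" "E' \<in> error_strings \<E> m"
  shows "Psi q \<E> m (basis_tens E E') = Psi_basis q \<E> m E E'"
  using assms by (simp add: Psi_def basis_tens_eq_single error_strings_def)

end

theory Submission
  imports Defs
begin

text \<open>
  An orthogonal unitary basis \<open>\<E>\<close> satisfies the completeness relation
  \<open>\<Sum>\<^sub>E cnj E\<^sub>a\<^sub>b * E\<^sub>c\<^sub>d = q\<close> if \<open>(a, b) = (c, d)\<close> and \<open>0\<close> otherwise, and this is inherited by the tensor
  products \<open>\<E>\<^sup>n\<close>. So \<open>M\<^sub>1\<close> expands in the \<open>E \<otimes>\<^sub>J F\<close> and \<open>M\<^sub>2\<close> in their adjoints. In a trace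
  \<open>Tr ((G \<otimes>\<^sub>J H)\<^sup>\<dagger> M\<^sub>1 (G' \<otimes>\<^sub>J H) M\<^sub>2)\<close> each pair of terms then contributes a product over positions.
  The positions in \<open>J\<close> give the matrix of \<open>\<Psi>\<close>. At a position outside \<open>J\<close> the factor is
  \<open>Tr (H\<^sup>\<dagger> F H F'\<^sup>\<dagger>)\<close>, which vanishes for \<open>F \<noteq> F'\<close> because \<open>H\<^sup>\<dagger> F H\<close> is a multiple of \<open>F\<close>; its sum over \<open>H\<close>
  with weights \<open>w\<close> (for \<open>H = I\<close>) and \<open>z\<close> (for \<open>H \<noteq> I\<close>) is \<open>q (w + (q\<^sup>2 - 1) z)\<close> for \<open>F = F' = I\<close> and
  \<open>q (w - z)\<close> for \<open>F = F' \<noteq> I\<close>. This is the substitution of the theorem.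
\<close>

section \<open>Matrices and Kronecker products\<close>

lemma mat_adjoint_carrier [simp]:
  assumes "A \<in> carrier_mat m n" shows "mat_adjoint A \<in> carrier_mat n m"
  using assms unfolding mat_adjoint_def by (metis carrier_matD cols_length length_map mat_of_rows_carrier(1))

lemma index_mat_adjoint:
  fixes A :: "complex mat"
  assumes "A \<in> carrier_mat m n" "i < n" "j < m"
  shows "mat_adjoint A $$ (i, j) = cnj (A $$ (j, i))"
  using assms unfolding mat_adjoint_def by (auto simp: mat_of_rows_def)

lemma index_mult_mat_sum:
  assumes "A \<in> carrier_mat l m" "B \<in> carrier_mat m n" "i < l" "j < n"
  shows "(A * B) $$ (i, j) = (\<Sum>k<m. A $$ (i, k) * B $$ (k, j))"
  using assms by (auto simp: scalar_prod_def atLeast0LessThan)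

lemma mat_tr_mult:
  assumes "A \<in> carrier_mat m n" "B \<in> carrier_mat n m"
  shows "mat_tr (A * B) = (\<Sum>i<m. \<Sum>j<n. A $$ (i, j) * B $$ (j, i))"
  using assms(1) unfolding mat_tr_def
  by (auto simp del: index_mult_mat(1) simp: index_mult_mat_sum[OF assms] intro!: sum.cong)

lemma mat_tr_mult_comm:
  assumes "A \<in> carrier_mat m n" "B \<in> carrier_mat n m"
  shows "mat_tr (A * B) = mat_tr (B * A)"
  unfolding mat_tr_mult[OF assms] mat_tr_mult[OF assms(2,1)]
  by (subst sum.swap) (simp add: mult.commute)

lemma mat_tr_smult: "A \<in> carrier_mat n n \<Longrightarrow> mat_tr (c \<cdot>\<^sub>m A) = c * mat_tr A"
  by (auto simp: mat_tr_def sum_distrib_left)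

lemma mat_tr_adjoint_mult:
  assumes "A \<in> carrier_mat d d" "B \<in> carrier_mat d d"
  shows "mat_tr (mat_adjoint A * B) = (\<Sum>i<d. \<Sum>j<d. cnj (A $$ (j, i)) * B $$ (j, i))"
  using assms by (simp add: mat_tr_mult[OF mat_adjoint_carrier[OF assms(1)] assms(2)] index_mat_adjoint[OF assms(1)])

lemma mat_tr_adjoint_mult_add:
  assumes "A \<in> carrier_mat d d" "B \<in> carrier_mat d d" "C \<in> carrier_mat d d"
  shows "mat_tr (mat_adjoint A * (B + C)) = mat_tr (mat_adjoint A * B) + mat_tr (mat_adjoint A * C)"
  using assms by (simp add: mat_tr_adjoint_mult sum.distrib algebra_simps)

lemma mat_tr_adjoint_mult_smult:
  assumes "A \<in> carrier_mat d d" "B \<in> carrier_mat d d"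
  shows "mat_tr (mat_adjoint A * (c \<cdot>\<^sub>m B)) = c * mat_tr (mat_adjoint A * B)"
  using assms by (simp add: mat_tr_adjoint_mult sum_distrib_left algebra_simps)

text \<open>Every index below \<open>a * b\<close> is \<open>j + i * b\<close> for unique
  \<open>i < a\<close> and \<open>j < b\<close>, its quotient and remainder. This is how an index of
  a Kronecker product splits into indices of the two factors.\<close>

lemma sum_div_mod:
  fixes f :: "nat \<Rightarrow> nat \<Rightarrow> 'a::comm_monoid_add"
  shows "(\<Sum>k<a * b. f (k div b) (k mod b)) = (\<Sum>i<a. \<Sum>j<b. f i j)"
proof -
  have less: "j + i * b < a * b" if "i < a" "j < b" for i j
  proof -
    have "j + i * b < Suc i * b" using that by simp
    also have "\<dots> \<le> a * b" using that by (intro mult_le_mono1) simp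
    finally show ?thesis .
  qed
  have "(\<Sum>k<a * b. f (k div b) (k mod b)) = (\<Sum>(i, j)\<in>{..<a} \<times> {..<b}. f i j)"
    by (rule sum.reindex_bij_witness[where i = "\<lambda>(i, j). j + i * b" and j = "\<lambda>k. (k div b, k mod b)"])
      (auto simp: less less_mult_imp_div_less intro!: mod_less_divisor gr0I)
  then show ?thesis by (simp add: sum.cartesian_product)
qed

lemma kron_carrier [simp]:
  assumes "A \<in> carrier_mat a a" "B \<in> carrier_mat b b"
  shows "kron A B \<in> carrier_mat (a * b) (a * b)"
  using assms by (auto simp: kron_def)

lemma index_kron:
  assumes "A \<in> carrier_mat a a" "B \<in> carrier_mat b b" "i < a * b" "j < a * b"
  shows "kron A B $$ (i, j) = A $$ (i div b, j div b) * B $$ (i mod b, j mod b)"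
  using assms by (auto simp: kron_def)

lemma div_mod_less:
  fixes a b i :: nat
  assumes "i < a * b" shows "i div b < a" "i mod b < b"
  using assms by (auto simp: less_mult_imp_div_less intro!: mod_less_divisor gr0I)

lemma mat_tr_kron:
  assumes A: "A \<in> carrier_mat a a" and B: "B \<in> carrier_mat b b"
  shows "mat_tr (kron A B) = mat_tr A * mat_tr B"
proof -
  have "mat_tr (kron A B) = (\<Sum>i<a * b. A $$ (i div b, i div b) * B $$ (i mod b, i mod b))"
    using kron_carrier[OF A B] by (auto simp: mat_tr_def index_kron[OF A B] intro!: sum.cong)
  also have "\<dots> = (\<Sum>i<a. \<Sum>j<b. A $$ (i, i) * B $$ (j, j))"
    by (rule sum_div_mod)
  also have "\<dots> = mat_tr A * mat_tr B"
    using A B by (simp add: mat_tr_def sum_product)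
  finally show ?thesis .
qed

lemma kron_mult:
  assumes A: "A \<in> carrier_mat a a" and B: "B \<in> carrier_mat b b"
    and C: "C \<in> carrier_mat a a" and D: "D \<in> carrier_mat b b"
  shows "kron A B * kron C D = kron (A * C) (B * D)"
proof (rule eq_matI)
  note AC = mult_carrier_mat[OF A C] and BD = mult_carrier_mat[OF B D]
  note AB' = kron_carrier[OF A B] and CD' = kron_carrier[OF C D]
  fix i j assume "i < dim_row (kron (A * C) (B * D))" "j < dim_col (kron (A * C) (B * D))"
  then have ij: "i < a * b" "j < a * b" using kron_carrier[OF AC BD] by auto
  note dm = div_mod_less[OF ij(1)] div_mod_less[OF ij(2)]
  have "(kron A B * kron C D) $$ (i, j)
      = (\<Sum>k<a * b. (A $$ (i div b, k div b) * B $$ (i mod b, k mod b))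
          * (C $$ (k div b, j div b) * D $$ (k mod b, j mod b)))"
    unfolding index_mult_mat_sum[OF AB' CD' ij]
    by (intro sum.cong refl) (simp add: index_kron[OF A B] index_kron[OF C D] ij)
  also have "\<dots> = (\<Sum>k<a. \<Sum>l<b. (A $$ (i div b, k) * B $$ (i mod b, l))
          * (C $$ (k, j div b) * D $$ (l, j mod b)))"
    by (rule sum_div_mod)
  also have "\<dots> = kron (A * C) (B * D) $$ (i, j)"
    by (simp add: index_kron[OF AC BD ij] index_mult_mat_sum[OF A C dm(1,3)]
        index_mult_mat_sum[OF B D dm(2,4)] sum_product ac_simps)
  finally show "(kron A B * kron C D) $$ (i, j) = kron (A * C) (B * D) $$ (i, j)" .
qed (use assms in \<open>auto simp: kron_def\<close>)

lemma mat_adjoint_kron: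
  assumes A: "A \<in> carrier_mat a a" and B: "B \<in> carrier_mat b b"
  shows "mat_adjoint (kron A B) = kron (mat_adjoint A) (mat_adjoint B)"
proof -
  note A' = mat_adjoint_carrier[OF A] and B' = mat_adjoint_carrier[OF B]
  note AB = kron_carrier[OF A B]
  show ?thesis
  proof (rule eq_matI)
    fix i j assume "i < dim_row (kron (mat_adjoint A) (mat_adjoint B))"
      "j < dim_col (kron (mat_adjoint A) (mat_adjoint B))"
    then have ij: "i < a * b" "j < a * b" using kron_carrier[OF A' B'] by auto
    note dm = div_mod_less[OF ij(1)] div_mod_less[OF ij(2)]
    show "mat_adjoint (kron A B) $$ (i, j) = kron (mat_adjoint A) (mat_adjoint B) $$ (i, j)"
      using ij dm by (simp add: index_mat_adjoint[OF AB] index_kron[OF A' B'] index_kron[OF A B]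
          index_mat_adjoint[OF A] index_mat_adjoint[OF B])
  qed (use kron_carrier[OF A' B'] mat_adjoint_carrier[OF AB] in auto)
qed

lemma tensor_op_Nil [simp]: "tensor_op [] = 1\<^sub>m 1"
  and tensor_op_Cons [simp]: "tensor_op (E # Es) = kron E (tensor_op Es)"
  by (simp_all add: tensor_op_def)

lemma tensor_op_carrier [simp]:
  "set Es \<subseteq> carrier_mat q q \<Longrightarrow> length Es = n \<Longrightarrow> tensor_op Es \<in> carrier_mat (q ^ n) (q ^ n)"
  by (induction Es arbitrary: n) auto

lemma mat_adjoint_one: "mat_adjoint (1\<^sub>m d :: complex mat) = 1\<^sub>m d"
proof (rule eq_matI)
  have c: "mat_adjoint (1\<^sub>m d :: complex mat) \<in> carrier_mat d d" by simp
  show "dim_row (mat_adjoint (1\<^sub>m d :: complex mat)) = dim_row (1\<^sub>m d :: complex mat)"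
    "dim_col (mat_adjoint (1\<^sub>m d :: complex mat)) = dim_col (1\<^sub>m d :: complex mat)"
    by (simp_all only: carrier_matD[OF c] index_one_mat)
qed (auto simp: index_mat_adjoint[OF one_carrier_mat])

text \<open>Adjoint, product and trace are all compatible with \<open>kron\<close>, so induction
  splits off one tensor factor at a time. The pattern with adjoints in first and last place is the
  one left after \<open>M1\<close> has been expanded in errors and \<open>M2\<close> in adjoints of
  errors.\<close>

lemma mat_tr_tensor_op_conj:
  assumes "length As = n" "length Bs = n" "length Cs = n" "length Ds = n"
    and "set As \<subseteq> carrier_mat q q" "set Bs \<subseteq> carrier_mat q q"
    and "set Cs \<subseteq> carrier_mat q q" "set Ds \<subseteq> carrier_mat q q"
  shows "mat_tr (mat_adjoint (tensor_op As) * tensor_op Bs * tensor_op Cs * mat_adjoint (tensor_op Ds))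
    = (\<Prod>i<n. mat_tr (mat_adjoint (As ! i) * Bs ! i * Cs ! i * mat_adjoint (Ds ! i)))"
  using assms
proof (induction n arbitrary: As Bs Cs Ds)
  case 0
  then show ?case by (simp add: mat_adjoint_one del: One_nat_def, simp add: mat_tr_def)
next
  case (Suc n)
  obtain A As' B Bs' C Cs' D Ds' where eq: "As = A # As'" "Bs = B # Bs'" "Cs = C # Cs'" "Ds = D # Ds'"
    using Suc.prems(1-4) by (metis length_Suc_conv)
  have c: "A \<in> carrier_mat q q" "B \<in> carrier_mat q q" "C \<in> carrier_mat q q" "D \<in> carrier_mat q q"
    and s: "set As' \<subseteq> carrier_mat q q" "set Bs' \<subseteq> carrier_mat q q"
      "set Cs' \<subseteq> carrier_mat q q" "set Ds' \<subseteq> carrier_mat q q"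
    and l: "length As' = n" "length Bs' = n" "length Cs' = n" "length Ds' = n"
    using Suc.prems unfolding eq by auto
  note t = tensor_op_carrier[OF s(1) l(1)] tensor_op_carrier[OF s(2) l(2)]
    tensor_op_carrier[OF s(3) l(3)] tensor_op_carrier[OF s(4) l(4)]
  note 1 = mult_carrier_mat[OF mat_adjoint_carrier[OF c(1)] c(2)]
    and 2 = mult_carrier_mat[OF mat_adjoint_carrier[OF t(1)] t(2)]
  note 3 = mult_carrier_mat[OF 1 c(3)] and 4 = mult_carrier_mat[OF 2 t(3)]
  note 5 = mult_carrier_mat[OF 3 mat_adjoint_carrier[OF c(4)]]
    and 6 = mult_carrier_mat[OF 4 mat_adjoint_carrier[OF t(4)]]
  have "mat_adjoint (tensor_op As) * tensor_op Bs * tensor_op Cs * mat_adjoint (tensor_op Ds)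
     = kron (mat_adjoint A * B * C * mat_adjoint D)
        (mat_adjoint (tensor_op As') * tensor_op Bs' * tensor_op Cs' * mat_adjoint (tensor_op Ds'))"
    unfolding eq tensor_op_Cons mat_adjoint_kron[OF c(1) t(1)] mat_adjoint_kron[OF c(4) t(4)]
      kron_mult[OF mat_adjoint_carrier[OF c(1)] mat_adjoint_carrier[OF t(1)] c(2) t(2)]
      kron_mult[OF 1 2 c(3) t(3)]
      kron_mult[OF 3 4 mat_adjoint_carrier[OF c(4)] mat_adjoint_carrier[OF t(4)]] ..
  then have "mat_tr (mat_adjoint (tensor_op As) * tensor_op Bs * tensor_op Cs * mat_adjoint (tensor_op Ds))
    = mat_tr (mat_adjoint A * B * C * mat_adjoint D) *
      (\<Prod>i<n. mat_tr (mat_adjoint (As' ! i) * Bs' ! i * Cs' ! i * mat_adjoint (Ds' ! i)))"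
    by (simp only: mat_tr_kron[OF 5 6] Suc.IH[OF l s])
  then show ?case by (simp only: eq prod.lessThan_Suc_shift nth_Cons_0 nth_Cons_Suc)
qed

section \<open>Sums over error strings\<close>

lemma error_strings_0 [simp]: "error_strings \<E> 0 = {[]}"
  by (auto simp: error_strings_def)

lemma sum_error_strings_Suc:
  fixes f :: "complex mat list \<Rightarrow> 'a::comm_monoid_add"
  shows "(\<Sum>S\<in>error_strings \<E> (Suc n). f S) = (\<Sum>E\<in>\<E>. \<Sum>S\<in>error_strings \<E> n. f (E # S))"
proof -
  have "(\<Sum>S\<in>error_strings \<E> (Suc n). f S) = (\<Sum>(E, S)\<in>\<E> \<times> error_strings \<E> n. f (E # S))"
    by (rule sum.reindex_bij_witness[where i = "\<lambda>(E, S). E # S" and j = "\<lambda>S. (hd S, tl S)"])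
      (auto simp: error_strings_def length_Suc_conv)
  then show ?thesis by (simp add: sum.cartesian_product)
qed

text \<open>Distributivity: multiplying out the right-hand side chooses one error at each position.
  The summand may depend on the position, as it does later through a fixed string
  \<open>F\<close>.\<close>

lemma sum_prod_error_strings:
  fixes f :: "nat \<Rightarrow> complex mat \<Rightarrow> 'a::comm_semiring_1"
  shows "(\<Sum>S\<in>error_strings \<E> n. \<Prod>i<n. f i (S ! i)) = (\<Prod>i<n. \<Sum>E\<in>\<E>. f i E)"
proof (induction n arbitrary: f)
  case (Suc n)
  show ?case
    by (simp add: sum_error_strings_Suc prod.lessThan_Suc_shift Suc.IH[of "\<lambda>i. f (Suc i)"]
        sum_distrib_left[symmetric] sum_distrib_right[symmetric] del: prod.lessThan_Suc)
qed simp

lemma finite_error_strings [simp]: "finite \<E> \<Longrightarrow> finite (error_strings \<E> n)"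
  unfolding error_strings_def by (rule finite_lists_length_eq)

lemma card_error_strings: "finite \<E> \<Longrightarrow> card (error_strings \<E> n) = card \<E> ^ n"
  unfolding error_strings_def by (rule card_lists_length_eq)

section \<open>Completeness of error bases\<close>

locale error_basis_on =
  fixes q :: nat and \<E> :: "complex mat set"
  assumes error_basis: "error_basis q \<E>"
begin

lemma error_basis_carrier: "\<E> \<subseteq> carrier_mat q q"
  using error_basis by (auto simp: error_basis_def unitary_mat_def)

lemma error_strings_set_carrier: "Es \<in> error_strings \<E> n \<Longrightarrow> set Es \<subseteq> carrier_mat q q"
  using error_basis_carrier by (auto simp: error_strings_def)

text \<open>The matrices with property \<open>P\<close> form a subspace containing
  \<open>\<E>\<close>, and \<open>\<E>\<close> spans all matrices. Claims that are linear in
  \<open>M\<close> are thereby reduced to the case that \<open>M\<close> is an error.\<close>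

lemma error_basis_submodule:
  assumes "\<And>E. E \<in> \<E> \<Longrightarrow> P E" and "P (0\<^sub>m q q)"
    and "\<And>A B. A \<in> carrier_mat q q \<Longrightarrow> B \<in> carrier_mat q q \<Longrightarrow> P A \<Longrightarrow> P B \<Longrightarrow> P (A + B)"
    and "\<And>c A. A \<in> carrier_mat q q \<Longrightarrow> P A \<Longrightarrow> P (c \<cdot>\<^sub>m A)"
    and "M \<in> carrier_mat q q"
  shows "P M"
proof -
  interpret vectorspace class_ring "module_mat TYPE(complex) q q" by (rule matrix_vs)
  have "submodule class_ring {A \<in> carrier_mat q q. P A} (module_mat TYPE(complex) q q)"
    by unfold_locales (use assms in \<open>auto simp: module_mat_simps\<close>)
  then have "span \<E> \<subseteq> {A \<in> carrier_mat q q. P A}"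
    using error_basis_carrier assms(1) by (intro span_is_subset) auto
  moreover have "span \<E> = carrier_mat q q"
    using error_basis unfolding error_basis_def basis_def by (auto simp: module_mat_simps)
  ultimately show ?thesis using assms(5) by auto
qed

text \<open>For \<open>q = 0\<close> the identity and the zero matrix coincide, so
  \<open>\<E>\<close> would contain the zero vector and could not be linearly independent.\<close>

lemma error_basis_dim_pos: "q > 0"
proof (rule ccontr)
  assume "\<not> q > 0"
  then have q: "q = 0" by simp
  interpret vectorspace class_ring "module_mat TYPE(complex) q q" by (rule matrix_vs)
  have "0\<^sub>m q q \<in> \<E>"
    using error_basis unfolding error_basis_def q by (metis eq_matI index_one_mat(2,3) index_zero_mat(2,3) less_nat_zero_code)
  moreover have "lin_indpt \<E>" using error_basis unfolding error_basis_def basis_def by auto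
  ultimately show False
    using vs_zero_lin_dep[of \<E>] error_basis_carrier by (auto simp: module_mat_simps)
qed

lemma mat_tr_error_basis:
  assumes E: "E \<in> \<E>" and F: "F \<in> \<E>"
  shows "mat_tr (mat_adjoint F * E) = (if E = F then of_nat q else 0)"
proof -
  have c: "E \<in> carrier_mat q q" "F \<in> carrier_mat q q" using assms error_basis_carrier by auto
  show ?thesis
  proof (cases "E = F")
    case True
    then have "mat_adjoint F * E = 1\<^sub>m q" using error_basis E by (auto simp: error_basis_def unitary_mat_def)
    then show ?thesis using True by (simp add: mat_tr_def)
  next
    case False
    then have "mat_tr (E * mat_adjoint F) = 0" using error_basis E F by (auto simp: error_basis_def)
    then show ?thesis using False mat_tr_mult_comm[OF c(1) mat_adjoint_carrier[OF c(2)]] by simp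
  qed
qed

text \<open>A fixed matrix is a finite combination of errors, hence orthogonal to all but finitely
  many of them. Doing this for the finitely many matrix units leaves finite exceptional sets; an
  error outside their union would be orthogonal to every matrix unit and hence zero, although its
  squared norm is \<open>q > 0\<close>.\<close>

lemma finite_error_basis: "finite \<E>"
proof -
  let ?P = "\<lambda>M. \<exists>A. finite A \<and> A \<subseteq> \<E> \<and> (\<forall>F\<in>\<E> - A. mat_tr (mat_adjoint F * M) = 0)"
  have P: "?P M" if "M \<in> carrier_mat q q" for M
  proof (rule error_basis_submodule[where P = ?P, OF _ _ _ _ that])
    fix E assume "E \<in> \<E>"
    then show "?P E" by (intro exI[of _ "{E}"]) (auto simp: mat_tr_error_basis)
  next
    show "?P (0\<^sub>m q q)"
      using error_basis_carrier by (intro exI[of _ "{}"]) (auto simp: subset_iff mat_tr_adjoint_mult[where d = q])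
  next
    fix A B assume AB: "A \<in> carrier_mat q q" "B \<in> carrier_mat q q" "?P A" "?P B"
    then obtain X Y where "finite X" "X \<subseteq> \<E>" "\<forall>F\<in>\<E> - X. mat_tr (mat_adjoint F * A) = 0"
      "finite Y" "Y \<subseteq> \<E>" "\<forall>F\<in>\<E> - Y. mat_tr (mat_adjoint F * B) = 0" by blast
    then show "?P (A + B)"
      using error_basis_carrier AB(1,2)
      by (intro exI[of _ "X \<union> Y"]) (auto simp: subset_iff mat_tr_adjoint_mult_add[where d = q])
  next
    fix c A assume A: "A \<in> carrier_mat q q" "?P A"
    then obtain X where "finite X" "X \<subseteq> \<E>" "\<forall>F\<in>\<E> - X. mat_tr (mat_adjoint F * A) = 0" by blast
    then show "?P (c \<cdot>\<^sub>m A)"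
      using error_basis_carrier A(1)
      by (intro exI[of _ X]) (auto simp: subset_iff mat_tr_adjoint_mult_smult[where d = q])
  qed
  \<comment> \<open>These are the matrix units. For indices out of range \<open>U\<close> gives the
    zero matrix, so \<open>?P (U p)\<close> holds for every \<open>p\<close> and \<open>A\<close>
    can be chosen without a side condition.\<close>
  define U where "U = (\<lambda>(i, j). mat q q (\<lambda>p. if p = (i, j) then 1 else 0 :: complex))"
  have "\<forall>p. ?P (U p)" using P by (auto simp: U_def)
  then obtain A where A: "\<And>p. finite (A p)" "\<And>p. A p \<subseteq> \<E>"
    "\<And>p F. F \<in> \<E> - A p \<Longrightarrow> mat_tr (mat_adjoint F * U p) = 0" by metis
  let ?A = "\<Union>p\<in>{..<q} \<times> {..<q}. A p"
  have "\<E> \<subseteq> ?A"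
  proof (rule subsetI, rule ccontr)
    fix F assume F: "F \<in> \<E>" "F \<notin> ?A"
    then have c: "F \<in> carrier_mat q q" using error_basis_carrier by auto
    have "F $$ (i, j) = 0" if ij: "i < q" "j < q" for i j
    proof -
      \<comment> \<open>Pairing \<open>F\<close> with the matrix unit at \<open>(i, j)\<close>
        isolates the conjugate of the entry of \<open>F\<close> there.\<close>
      have "(\<Sum>b<q. \<Sum>a<q. cnj (F $$ (a, b)) * U (i, j) $$ (a, b)) = 0"
        using A(3)[of F "(i, j)"] F ij by (subst mat_tr_adjoint_mult[symmetric, OF c]) (auto simp: U_def)
      moreover have "(\<Sum>b<q. \<Sum>a<q. cnj (F $$ (a, b)) * U (i, j) $$ (a, b))
        = (\<Sum>b<q. \<Sum>a<q. if a = i then (if b = j then cnj (F $$ (i, j)) else 0) else 0)"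
        by (intro sum.cong) (auto simp: U_def)
      ultimately show ?thesis using ij by simp
    qed
    then have "mat_tr (mat_adjoint F * F) = 0" by (simp add: mat_tr_adjoint_mult[OF c c])
    then show False using mat_tr_error_basis[OF F(1) F(1)] error_basis_dim_pos by simp
  qed
  then show ?thesis by (rule finite_subset) (auto simp: A(1))
qed

text \<open>Both sides are linear in \<open>M\<close>, and for \<open>M\<close> in
  \<open>\<E>\<close> orthogonality leaves the single term \<open>E = M\<close>, whose trace is
  \<open>q\<close>.\<close>

lemma error_basis_expansion:
  assumes M: "M \<in> carrier_mat q q" and ij: "i < q" "j < q"
  shows "of_nat q * M $$ (i, j) = (\<Sum>E\<in>\<E>. mat_tr (mat_adjoint E * M) * E $$ (i, j))"
proof (rule error_basis_submodule[OF _ _ _ _ M])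
  fix F assume "F \<in> \<E>"
  then show "of_nat q * F $$ (i, j) = (\<Sum>E\<in>\<E>. mat_tr (mat_adjoint E * F) * E $$ (i, j))"
    by (simp add: mat_tr_error_basis if_distrib[of "\<lambda>x. x * _"] finite_error_basis cong: if_cong)
next
  show "of_nat q * 0\<^sub>m q q $$ (i, j) = (\<Sum>E\<in>\<E>. mat_tr (mat_adjoint E * 0\<^sub>m q q) * E $$ (i, j))"
    using ij error_basis_carrier by (auto simp: mat_tr_adjoint_mult[where d = q] subset_iff intro!: sum.neutral)
next
  fix A B assume AB: "A \<in> carrier_mat q q" "B \<in> carrier_mat q q"
    "of_nat q * A $$ (i, j) = (\<Sum>E\<in>\<E>. mat_tr (mat_adjoint E * A) * E $$ (i, j))"
    "of_nat q * B $$ (i, j) = (\<Sum>E\<in>\<E>. mat_tr (mat_adjoint E * B) * E $$ (i, j))"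
  have "(\<Sum>E\<in>\<E>. mat_tr (mat_adjoint E * (A + B)) * E $$ (i, j))
    = (\<Sum>E\<in>\<E>. mat_tr (mat_adjoint E * A) * E $$ (i, j) + mat_tr (mat_adjoint E * B) * E $$ (i, j))"
    using error_basis_carrier AB(1,2)
    by (intro sum.cong refl) (auto simp: subset_iff mat_tr_adjoint_mult_add[where d = q] algebra_simps)
  then show "of_nat q * (A + B) $$ (i, j) = (\<Sum>E\<in>\<E>. mat_tr (mat_adjoint E * (A + B)) * E $$ (i, j))"
    using AB ij by (simp add: sum.distrib distrib_left)
next
  fix c A assume A: "A \<in> carrier_mat q q"
    "of_nat q * A $$ (i, j) = (\<Sum>E\<in>\<E>. mat_tr (mat_adjoint E * A) * E $$ (i, j))"
  have "(\<Sum>E\<in>\<E>. mat_tr (mat_adjoint E * (c \<cdot>\<^sub>m A)) * E $$ (i, j))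
    = (\<Sum>E\<in>\<E>. c * (mat_tr (mat_adjoint E * A) * E $$ (i, j)))"
    using error_basis_carrier A(1)
    by (intro sum.cong refl) (auto simp: subset_iff mat_tr_adjoint_mult_smult[where d = q])
  then show "of_nat q * (c \<cdot>\<^sub>m A) $$ (i, j) = (\<Sum>E\<in>\<E>. mat_tr (mat_adjoint E * (c \<cdot>\<^sub>m A)) * E $$ (i, j))"
    using A ij by (simp add: sum_distrib_left[symmetric])
qed

text \<open>This is the expansion of the matrix unit at \<open>(a, b)\<close>: its coefficient along
  \<open>E\<close> is the conjugate of the entry of \<open>E\<close> at
  \<open>(a, b)\<close>.\<close>

lemma error_basis_complete:
  assumes "a < q" "b < q" "c < q" "d < q"
  shows "(\<Sum>E\<in>\<E>. cnj (E $$ (a, b)) * E $$ (c, d)) = (if a = c \<and> b = d then of_nat q else 0)"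
proof -
  define U where "U = mat q q (\<lambda>p. if p = (a, b) then 1 else 0 :: complex)"
  have U: "U \<in> carrier_mat q q" by (simp add: U_def)
  have "mat_tr (mat_adjoint E * U) = cnj (E $$ (a, b))" if "E \<in> \<E>" for E
  proof -
    have c: "E \<in> carrier_mat q q" using that error_basis_carrier by auto
    have "mat_tr (mat_adjoint E * U)
        = (\<Sum>y<q. \<Sum>x<q. if x = a then (if y = b then cnj (E $$ (a, b)) else 0) else 0)"
      unfolding mat_tr_adjoint_mult[OF c U] by (intro sum.cong) (auto simp: U_def)
    then show ?thesis using assms by simp
  qed
  then have "(\<Sum>E\<in>\<E>. cnj (E $$ (a, b)) * E $$ (c, d)) = of_nat q * U $$ (c, d)"
    unfolding error_basis_expansion[OF U assms(3,4)] by simp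
  then show ?thesis using assms by (auto simp: U_def)
qed

text \<open>Splitting all four indices by quotient and remainder separates the first factor from the
  rest, so the sum is a product of two completeness relations. Two indices agree exactly if
  quotients and remainders both agree.\<close>

lemma tensor_op_complete:
  assumes "a < q ^ n" "b < q ^ n" "c < q ^ n" "d < q ^ n"
  shows "(\<Sum>S\<in>error_strings \<E> n. cnj (tensor_op S $$ (a, b)) * tensor_op S $$ (c, d))
    = (if a = c \<and> b = d then of_nat q ^ n else 0)"
  using assms
proof (induction n arbitrary: a b c d)
  case (Suc n)
  let ?N = "q ^ n"
  have lt: "a < q * ?N" "b < q * ?N" "c < q * ?N" "d < q * ?N" using Suc.prems by auto
  note dm = div_mod_less[OF lt(1)] div_mod_less[OF lt(2)] div_mod_less[OF lt(3)] div_mod_less[OF lt(4)]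
  have "(\<Sum>S\<in>error_strings \<E> (Suc n). cnj (tensor_op S $$ (a, b)) * tensor_op S $$ (c, d))
    = (\<Sum>E\<in>\<E>. \<Sum>S\<in>error_strings \<E> n.
        (cnj (E $$ (a div ?N, b div ?N)) * E $$ (c div ?N, d div ?N)) *
        (cnj (tensor_op S $$ (a mod ?N, b mod ?N)) * tensor_op S $$ (c mod ?N, d mod ?N)))"
    unfolding sum_error_strings_Suc tensor_op_Cons
  proof (intro sum.cong refl)
    fix E S assume "E \<in> \<E>" "S \<in> error_strings \<E> n"
    then have E: "E \<in> carrier_mat q q" and S: "tensor_op S \<in> carrier_mat ?N ?N"
      using error_basis_carrier error_strings_set_carrier[of S n] by (auto simp: error_strings_def)
    show "cnj (kron E (tensor_op S) $$ (a, b)) * kron E (tensor_op S) $$ (c, d)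
      = (cnj (E $$ (a div ?N, b div ?N)) * E $$ (c div ?N, d div ?N)) *
        (cnj (tensor_op S $$ (a mod ?N, b mod ?N)) * tensor_op S $$ (c mod ?N, d mod ?N))"
      by (simp add: index_kron[OF E S] lt)
  qed
  also have "\<dots> = (if a div ?N = c div ?N \<and> b div ?N = d div ?N then of_nat q else 0)
      * (if a mod ?N = c mod ?N \<and> b mod ?N = d mod ?N then of_nat q ^ n else 0)"
    unfolding sum_product[symmetric]
    by (subst error_basis_complete, (rule dm)+, subst Suc.IH, (rule dm)+, rule refl)
  also have "\<dots> = (if a = c \<and> b = d then of_nat q ^ Suc n else 0)"
  proof -
    have "a = c \<longleftrightarrow> a div ?N = c div ?N \<and> a mod ?N = c mod ?N"
      "b = d \<longleftrightarrow> b div ?N = d div ?N \<and> b mod ?N = d mod ?N"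
      by (metis div_mult_mod_eq)+
    then show ?thesis by auto
  qed
  finally show ?case .
qed simp

end

section \<open>Expansion of traces in tensor products of errors\<close>

lemma mat_tr_mult4:
  assumes A: "A \<in> carrier_mat d d" and B: "B \<in> carrier_mat d d"
    and C: "C \<in> carrier_mat d d" and D: "D \<in> carrier_mat d d"
  shows "mat_tr (A * B * C * D) = (\<Sum>(i, j, k, l)\<in>{..<d} \<times> {..<d} \<times> {..<d} \<times> {..<d}.
    A $$ (i, j) * B $$ (j, k) * C $$ (k, l) * D $$ (l, i))"
proof -
  note AB = mult_carrier_mat[OF A B]
  note ABC = mult_carrier_mat[OF AB C]
  have "mat_tr (A * B * C * D) = (\<Sum>i<d. \<Sum>l<d. \<Sum>k<d. \<Sum>j<d.
      A $$ (i, j) * B $$ (j, k) * C $$ (k, l) * D $$ (l, i))"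
    unfolding mat_tr_mult[OF ABC D]
    by (simp add: index_mult_mat_sum[OF ABC D] index_mult_mat_sum[OF AB C] index_mult_mat_sum[OF A B]
        sum_distrib_right del: index_mult_mat(1))
  also have "\<dots> = (\<Sum>i<d. \<Sum>j<d. \<Sum>k<d. \<Sum>l<d.
      A $$ (i, j) * B $$ (j, k) * C $$ (k, l) * D $$ (l, i))"
  proof (rule sum.cong[OF refl])
    fix i
    let ?f = "\<lambda>j k l. A $$ (i, j) * B $$ (j, k) * C $$ (k, l) * D $$ (l, i)"
    have "(\<Sum>l<d. \<Sum>k<d. \<Sum>j<d. ?f j k l) = (\<Sum>l<d. \<Sum>j<d. \<Sum>k<d. ?f j k l)"
      by (intro sum.cong refl sum.swap)
    also have "\<dots> = (\<Sum>j<d. \<Sum>l<d. \<Sum>k<d. ?f j k l)" by (rule sum.swap)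
    also have "\<dots> = (\<Sum>j<d. \<Sum>k<d. \<Sum>l<d. ?f j k l)" by (intro sum.cong refl sum.swap)
    finally show "(\<Sum>l<d. \<Sum>k<d. \<Sum>j<d. ?f j k l) = (\<Sum>j<d. \<Sum>k<d. \<Sum>l<d. ?f j k l)" .
  qed
  finally show ?thesis by (simp add: sum.cartesian_product)
qed

text \<open>The trace is linear in the second factor. Stating the expansion of \<open>B\<close>
  entrywise avoids sums of matrices, and keeping \<open>r\<close> on the left avoids
  division.\<close>

lemma mat_tr_sum_second:
  assumes A: "A \<in> carrier_mat d d" and B: "B \<in> carrier_mat d d"
    and C: "C \<in> carrier_mat d d" and D: "D \<in> carrier_mat d d"
    and X: "\<And>S. S \<in> I \<Longrightarrow> X S \<in> carrier_mat d d"
    and eq: "\<And>i j. i < d \<Longrightarrow> j < d \<Longrightarrow> r * B $$ (i, j) = (\<Sum>S\<in>I. c S * X S $$ (i, j))"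
  shows "r * mat_tr (A * B * C * D) = (\<Sum>S\<in>I. c S * mat_tr (A * X S * C * D))"
proof -
  let ?D = "{..<d} \<times> {..<d} \<times> {..<d} \<times> {..<d}"
  have "r * mat_tr (A * B * C * D)
      = (\<Sum>(i, j, k, l)\<in>?D. A $$ (i, j) * (r * B $$ (j, k)) * C $$ (k, l) * D $$ (l, i))"
    unfolding mat_tr_mult4[OF A B C D] sum_distrib_left by (intro sum.cong) auto
  also have "\<dots> = (\<Sum>(i, j, k, l)\<in>?D. \<Sum>S\<in>I. c S * (A $$ (i, j) * X S $$ (j, k) * C $$ (k, l) * D $$ (l, i)))"
    by (intro sum.cong refl)
      (auto simp: eq sum_distrib_left sum_distrib_right intro!: sum.cong)
  also have "\<dots> = (\<Sum>S\<in>I. \<Sum>(i, j, k, l)\<in>?D. c S * (A $$ (i, j) * X S $$ (j, k) * C $$ (k, l) * D $$ (l, i)))"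
    unfolding split_def by (rule sum.swap)
  also have "\<dots> = (\<Sum>S\<in>I. c S * mat_tr (A * X S * C * D))"
    by (intro sum.cong refl) (simp add: mat_tr_mult4[OF A X C D] sum_distrib_left split_def)
  finally show ?thesis .
qed

text \<open>Rotating by two places brings the fourth factor to the second place, so that
  \<open>mat_tr_sum_second\<close> also serves for expanding \<open>M2\<close>.\<close>

lemma mat_tr_rotate2:
  assumes A: "A \<in> carrier_mat d d" and B: "B \<in> carrier_mat d d"
    and C: "C \<in> carrier_mat d d" and D: "D \<in> carrier_mat d d"
  shows "mat_tr (A * B * C * D) = mat_tr (C * D * A * B)"
  using mat_tr_mult_comm[of "A * B" d d "C * D"] A B C D by (simp add: assoc_mult_mat[of _ d d _ d _ d])

context error_basis_on
begin

lemma tensor_op_error_strings: "S \<in> error_strings \<E> n \<Longrightarrow> tensor_op S \<in> carrier_mat (q ^ n) (q ^ n)"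
  using error_strings_set_carrier[of S n] by (auto simp: error_strings_def)

text \<open>Writing the trace as a sum over entries \<open>(a, b)\<close> and summing over
  \<open>S\<close> first, completeness retains only \<open>(a, b) = (i, j)\<close>.\<close>

lemma tensor_op_expansion:
  assumes M: "M \<in> carrier_mat (q ^ n) (q ^ n)" and ij: "i < q ^ n" "j < q ^ n"
  shows "of_nat q ^ n * M $$ (i, j)
    = (\<Sum>S\<in>error_strings \<E> n. mat_tr (mat_adjoint (tensor_op S) * M) * tensor_op S $$ (i, j))"
proof -
  let ?d = "q ^ n"
  have "(\<Sum>S\<in>error_strings \<E> n. mat_tr (mat_adjoint (tensor_op S) * M) * tensor_op S $$ (i, j))
    = (\<Sum>S\<in>error_strings \<E> n. \<Sum>b<?d. \<Sum>a<?d.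
        (cnj (tensor_op S $$ (a, b)) * tensor_op S $$ (i, j)) * M $$ (a, b))"
    by (intro sum.cong refl)
      (simp add: mat_tr_adjoint_mult[OF tensor_op_error_strings M] sum_distrib_right sum_distrib_left ac_simps)
  also have "\<dots> = (\<Sum>b<?d. \<Sum>a<?d. \<Sum>S\<in>error_strings \<E> n.
        (cnj (tensor_op S $$ (a, b)) * tensor_op S $$ (i, j)) * M $$ (a, b))"
    by (subst sum.swap, intro sum.cong refl sum.swap)
  also have "\<dots> = (\<Sum>b<?d. \<Sum>a<?d. if a = i then (if b = j then of_nat q ^ n * M $$ (i, j) else 0) else 0)"
    by (intro sum.cong refl) (auto simp: sum_distrib_right[symmetric] tensor_op_complete ij)
  also have "\<dots> = of_nat q ^ n * M $$ (i, j)" using ij by simp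
  finally show ?thesis ..
qed

text \<open>The same argument with the roles of an error and its adjoint exchanged. This form is
  needed for \<open>M2\<close>, which the enumerator A pairs with errors that carry no
  adjoint.\<close>

lemma tensor_op_expansion_adjoint:
  assumes M: "M \<in> carrier_mat (q ^ n) (q ^ n)" and ij: "i < q ^ n" "j < q ^ n"
  shows "of_nat q ^ n * M $$ (i, j)
    = (\<Sum>S\<in>error_strings \<E> n. mat_tr (tensor_op S * M) * mat_adjoint (tensor_op S) $$ (i, j))"
proof -
  let ?d = "q ^ n"
  have "(\<Sum>S\<in>error_strings \<E> n. mat_tr (tensor_op S * M) * mat_adjoint (tensor_op S) $$ (i, j))
    = (\<Sum>S\<in>error_strings \<E> n. \<Sum>a<?d. \<Sum>b<?d.
        (cnj (tensor_op S $$ (j, i)) * tensor_op S $$ (a, b)) * M $$ (b, a))"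
    by (intro sum.cong refl)
      (simp add: mat_tr_mult[OF tensor_op_error_strings M] index_mat_adjoint[OF tensor_op_error_strings] ij
        sum_distrib_right sum_distrib_left ac_simps)
  also have "\<dots> = (\<Sum>a<?d. \<Sum>b<?d. \<Sum>S\<in>error_strings \<E> n.
        (cnj (tensor_op S $$ (j, i)) * tensor_op S $$ (a, b)) * M $$ (b, a))"
    by (subst sum.swap, intro sum.cong refl sum.swap)
  also have "\<dots> = (\<Sum>a<?d. \<Sum>b<?d. if b = i then (if a = j then of_nat q ^ n * M $$ (i, j) else 0) else 0)"
    by (intro sum.cong refl) (auto simp: sum_distrib_right[symmetric] tensor_op_complete ij)
  also have "\<dots> = of_nat q ^ n * M $$ (i, j)" using ij by simp
  finally show ?thesis ..
qed

lemma mat_tr_expansion: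
  assumes M: "M1 \<in> carrier_mat (q ^ n) (q ^ n)" "M2 \<in> carrier_mat (q ^ n) (q ^ n)"
    and X: "X \<in> carrier_mat (q ^ n) (q ^ n)" and Y: "Y \<in> carrier_mat (q ^ n) (q ^ n)"
  shows "of_nat q ^ (2 * n) * mat_tr (X * M1 * Y * M2)
    = (\<Sum>S\<in>error_strings \<E> n. \<Sum>S'\<in>error_strings \<E> n.
        mat_tr (mat_adjoint (tensor_op S) * M1) * mat_tr (tensor_op S' * M2)
        * mat_tr (X * tensor_op S * Y * mat_adjoint (tensor_op S')))"
proof -
  note t = tensor_op_error_strings[where n = n] and ta = mat_adjoint_carrier[OF tensor_op_error_strings[where n = n]]
  let ?I = "error_strings \<E> n" and ?r = "of_nat q ^ n :: complex"
  have 1: "?r * mat_tr (X * M1 * Y * M2)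
    = (\<Sum>S\<in>?I. mat_tr (mat_adjoint (tensor_op S) * M1) * mat_tr (X * tensor_op S * Y * M2))"
    by (rule mat_tr_sum_second[OF X M(1) Y M(2) t tensor_op_expansion[OF M(1)]])
  \<comment> \<open>The second factor \<open>Z\<close> is left general because \<open>M1\<close> has
    by then been replaced by a tensor product of errors.\<close>
  have 2: "?r * mat_tr (X * Z * Y * M2)
    = (\<Sum>S'\<in>?I. mat_tr (tensor_op S' * M2) * mat_tr (X * Z * Y * mat_adjoint (tensor_op S')))"
    if Z: "Z \<in> carrier_mat (q ^ n) (q ^ n)" for Z
    using mat_tr_sum_second[OF Y M(2) X Z ta tensor_op_expansion_adjoint[OF M(2)]]
    by (simp add: mat_tr_rotate2[OF X Z Y] M(2) ta cong: sum.cong)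
  have "of_nat q ^ (2 * n) * mat_tr (X * M1 * Y * M2)
      = (\<Sum>S\<in>?I. mat_tr (mat_adjoint (tensor_op S) * M1) * (?r * mat_tr (X * tensor_op S * Y * M2)))"
    using arg_cong[OF 1, of "\<lambda>x. ?r * x"] by (simp add: power_mult power2_eq_square power_mult_distrib sum_distrib_left ac_simps)
  also have "\<dots> = (\<Sum>S\<in>?I. \<Sum>S'\<in>?I.
        mat_tr (mat_adjoint (tensor_op S) * M1) * mat_tr (tensor_op S' * M2)
        * mat_tr (X * tensor_op S * Y * mat_adjoint (tensor_op S')))"
    by (intro sum.cong refl) (simp add: 2[OF t] sum_distrib_left mult.assoc)
  finally show ?thesis .
qed

section \<open>Conjugation traces at a single position\<close>

lemma mat_tr_conj_neq:
  assumes H: "H \<in> \<E>" and F: "F \<in> \<E>" "F' \<in> \<E>" "F \<noteq> F'"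
  shows "mat_tr (mat_adjoint H * F * H * mat_adjoint F') = 0"
proof -
  obtain \<omega> where \<omega>: "F * H = \<omega> \<cdot>\<^sub>m (H * F)" using error_basis H F unfolding error_basis_def by blast
  have c: "H \<in> carrier_mat q q" "F \<in> carrier_mat q q" "F' \<in> carrier_mat q q"
    using H F error_basis_carrier by auto
  note ca = c[THEN mat_adjoint_carrier]
  have u: "mat_adjoint H * H = 1\<^sub>m q" using error_basis H by (auto simp: error_basis_def unitary_mat_def)
  \<comment> \<open>Moving \<open>H\<close> past \<open>F\<close> costs only the scalar \<omega>,
    and then unitarity cancels \<open>H\<close>. What remains is \<omega> times the inner product of
    two distinct errors.\<close>
  have "mat_adjoint H * F * H = mat_adjoint H * (F * H)"
    by (rule assoc_mult_mat[OF ca(1) c(2,1)])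
  also have "\<dots> = \<omega> \<cdot>\<^sub>m (mat_adjoint H * (H * F))"
    unfolding \<omega> by (rule mult_smult_distrib[OF ca(1) mult_carrier_mat[OF c(1,2)]])
  also have "mat_adjoint H * (H * F) = F"
    using c by (simp add: assoc_mult_mat[OF ca(1) c(1,2), symmetric] u)
  finally have "mat_adjoint H * F * H * mat_adjoint F' = \<omega> \<cdot>\<^sub>m (F * mat_adjoint F')"
    using mult_smult_assoc_mat[OF c(2) ca(3)] by simp
  moreover have "mat_tr (F * mat_adjoint F') = 0" using error_basis F by (auto simp: error_basis_def)
  ultimately show ?thesis using mat_tr_smult[OF mult_carrier_mat[OF c(2) ca(3)]] by simp
qed

lemma one_in_error_basis: "1\<^sub>m q \<in> \<E>"
  using error_basis by (auto simp: error_basis_def)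

lemma mat_tr_error: "F \<in> \<E> \<Longrightarrow> mat_tr F = (if F = 1\<^sub>m q then of_nat q else 0)"
  using mat_tr_error_basis[OF _ one_in_error_basis, of F] error_basis_carrier
  by (auto simp: mat_adjoint_one left_mult_one_mat[of F q q])

text \<open>Twirling by an orthogonal unitary basis is the completely depolarising channel.\<close>

lemma sum_mat_tr_conj:
  assumes F: "F \<in> \<E>"
  shows "(\<Sum>H\<in>\<E>. mat_tr (mat_adjoint H * F * H * mat_adjoint F)) = (if F = 1\<^sub>m q then of_nat q ^ 3 else 0)"
proof -
  let ?D = "{..<q} \<times> {..<q} \<times> {..<q} \<times> {..<q}"
  have c: "F \<in> carrier_mat q q" using F error_basis_carrier by auto
  have "(\<Sum>H\<in>\<E>. mat_tr (mat_adjoint H * F * H * mat_adjoint F))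
      = (\<Sum>H\<in>\<E>. \<Sum>(i, j, k, l)\<in>?D. cnj (H $$ (j, i)) * F $$ (j, k) * H $$ (k, l) * cnj (F $$ (i, l)))"
  proof (intro sum.cong refl)
    fix H assume "H \<in> \<E>"
    then have H: "H \<in> carrier_mat q q" using error_basis_carrier by auto
    show "mat_tr (mat_adjoint H * F * H * mat_adjoint F)
      = (\<Sum>(i, j, k, l)\<in>?D. cnj (H $$ (j, i)) * F $$ (j, k) * H $$ (k, l) * cnj (F $$ (i, l)))"
      unfolding mat_tr_mult4[OF mat_adjoint_carrier[OF H] c H mat_adjoint_carrier[OF c]]
      by (intro sum.cong refl) (auto simp: index_mat_adjoint[OF H] index_mat_adjoint[OF c])
  qed
  \<comment> \<open>Completeness in the sum over \<open>H\<close> forces \<open>k = j\<close> and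
    \<open>l = i\<close>, which leaves \<open>q\<close> times the squared modulus of the trace of
    \<open>F\<close>. That trace is \<open>q\<close> for the identity and 0 for any other
    error.\<close>
  also have "\<dots> = (\<Sum>(i, j, k, l)\<in>?D. (\<Sum>H\<in>\<E>. cnj (H $$ (j, i)) * H $$ (k, l)) * (F $$ (j, k) * cnj (F $$ (i, l))))"
    unfolding split_def by (subst sum.swap) (simp add: sum_distrib_left sum_distrib_right ac_simps)
  also have "\<dots> = (\<Sum>(i, j, k, l)\<in>?D. if k = j then if l = i then of_nat q * (F $$ (j, j) * cnj (F $$ (i, i))) else 0 else 0)"
    by (intro sum.cong refl) (auto simp: error_basis_complete)
  also have "\<dots> = (\<Sum>i<q. \<Sum>j<q. \<Sum>k<q. \<Sum>l<q. if k = j then if l = i then of_nat q * (F $$ (j, j) * cnj (F $$ (i, i))) else 0 else 0)"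
    by (simp add: sum.cartesian_product)
  also have "\<dots> = (\<Sum>i<q. \<Sum>j<q. \<Sum>k<q. if k = j then of_nat q * (F $$ (j, j) * cnj (F $$ (i, i))) else 0)"
    by (intro sum.cong refl) auto
  also have "\<dots> = (\<Sum>i<q. \<Sum>j<q. of_nat q * (F $$ (j, j) * cnj (F $$ (i, i))))"
    by (intro sum.cong refl) auto
  also have "\<dots> = of_nat q * (mat_tr F * cnj (mat_tr F))"
    using c by (auto simp: mat_tr_def sum_distrib_left sum_distrib_right)
  also have "\<dots> = (if F = 1\<^sub>m q then of_nat q ^ 3 else 0)"
    by (simp add: mat_tr_error[OF F] power3_eq_cube)
  finally show ?thesis .
qed

end

section \<open>Interleaving\<close>

text \<open>The rank, the number of smaller elements, increases strictly along \<open>J\<close> and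
  stays below \<open>card J\<close>; an injection between finite sets of equal size is a bijection.
  It is the numbering used by \<open>interleave\<close>.\<close>

lemma bij_betw_rank:
  fixes J :: "nat set"
  assumes "finite J"
  shows "bij_betw (\<lambda>k. card {j \<in> J. j < k}) J {..<card J}"
proof -
  have less: "card {j \<in> J. j < k} < card {j \<in> J. j < l}" if "k \<in> J" "k < l" for k l
    using that assms by (intro psubset_card_mono) auto
  have inj: "inj_on (\<lambda>k. card {j \<in> J. j < k}) J"
    by (rule linorder_inj_onI') (auto dest: less)
  have "(\<lambda>k. card {j \<in> J. j < k}) ` J \<subseteq> {..<card J}"
    using assms by (auto intro!: psubset_card_mono)
  then show ?thesis
    using card_image[OF inj] by (simp add: bij_betw_def inj card_subset_eq)
qed

text \<open>Positions are sorted into \<open>J\<close> and its complement, and each part is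
  reindexed by rank. \<open>Suc k\<close> appears because the list index \<open>k\<close> belongs to
  position \<open>k + 1\<close>.\<close>

lemma prod_split_rank:
  fixes f g :: "nat \<Rightarrow> 'a::comm_monoid_mult"
  assumes J: "J \<subseteq> {1..n}"
  shows "(\<Prod>k<n. if Suc k \<in> J then f (card {j\<in>J. j < Suc k}) else g (card {j\<in>{1..n} - J. j < Suc k}))
    = (\<Prod>i<card J. f i) * (\<Prod>i<n - card J. g i)"
proof -
  have fin: "finite J" using J finite_subset by blast
  have "(\<Prod>k<n. if Suc k \<in> J then f (card {j\<in>J. j < Suc k}) else g (card {j\<in>{1..n} - J. j < Suc k}))
    = (\<Prod>k\<in>{1..n}. if k \<in> J then f (card {j\<in>J. j < k}) else g (card {j\<in>{1..n} - J. j < k}))"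
    by (rule prod.reindex_bij_witness[of _ "\<lambda>k. k - 1" Suc]) auto
  also have "\<dots> = (\<Prod>k\<in>J. f (card {j\<in>J. j < k})) * (\<Prod>k\<in>{1..n} - J. g (card {j\<in>{1..n} - J. j < k}))"
    using J by (simp add: prod.If_cases Int_absorb1 Diff_eq)
  also have "(\<Prod>k\<in>J. f (card {j\<in>J. j < k})) = (\<Prod>i<card J. f i)"
    by (rule prod.reindex_bij_betw[OF bij_betw_rank[OF fin]])
  also have "(\<Prod>k\<in>{1..n} - J. g (card {j\<in>{1..n} - J. j < k})) = (\<Prod>i<card ({1..n} - J). g i)"
    by (rule prod.reindex_bij_betw[OF bij_betw_rank]) simp
  also have "card ({1..n} - J) = n - card J" using J fin by (simp add: card_Diff_subset)
  finally show ?thesis .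
qed

lemma length_interleave [simp]: "length (interleave n J E F) = n"
  by (simp add: interleave_def)

lemma nth_interleave:
  "k < n \<Longrightarrow> interleave n J E F ! k = (if Suc k \<in> J then E ! card {j\<in>J. j < Suc k}
    else F ! card {j\<in>{1..n} - J. j < Suc k})"
  by (simp add: interleave_def del: upt_Suc)

lemma rank_less:
  assumes "J \<subseteq> {1..n}" "k < n"
  shows "Suc k \<in> J \<Longrightarrow> card {j\<in>J. j < Suc k} < card J"
    and "Suc k \<notin> J \<Longrightarrow> card {j\<in>{1..n} - J. j < Suc k} < n - card J"
proof -
  have fin: "finite J" using assms(1) finite_subset by blast
  have c: "card ({1..n} - J) = n - card J" using assms(1) fin by (simp add: card_Diff_subset)
  show "card {j\<in>J. j < Suc k} < card J" if "Suc k \<in> J"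
    using bij_betwE[OF bij_betw_rank[OF fin]] that by auto
  show "card {j\<in>{1..n} - J. j < Suc k} < n - card J" if "Suc k \<notin> J"
    using bij_betwE[OF bij_betw_rank[of "{1..n} - J"]] that c assms(2) by auto
qed

lemma interleave_error_strings:
  assumes "J \<subseteq> {1..n}" "E \<in> error_strings \<E> (card J)" "F \<in> error_strings \<E> (n - card J)"
  shows "interleave n J E F \<in> error_strings \<E> n"
proof -
  have "interleave n J E F ! k \<in> \<E>" if "k < n" for k
    using that rank_less[OF assms(1) that] assms(2,3)
    by (auto simp: nth_interleave error_strings_def intro!: subsetD[OF _ nth_mem])
  then show ?thesis by (auto simp: error_strings_def in_set_conv_nth)
qed

text \<open>Every rank is attained, so each entry of \<open>E\<close> and of \<open>F\<close> can be
  read off at some position of the interleaved list.\<close>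

lemma inj_on_interleave:
  assumes J: "J \<subseteq> {1..n}"
  shows "inj_on (\<lambda>(E, F). interleave n J E F) (error_strings \<E> (card J) \<times> error_strings \<E> (n - card J))"
proof (rule inj_onI, clarify)
  fix E F E' F' assume E: "E \<in> error_strings \<E> (card J)" "E' \<in> error_strings \<E> (card J)"
    and F: "F \<in> error_strings \<E> (n - card J)" "F' \<in> error_strings \<E> (n - card J)"
    and eq: "interleave n J E F = interleave n J E' F'"
  have fin: "finite J" using J finite_subset by blast
  have c: "card ({1..n} - J) = n - card J" using J fin by (simp add: card_Diff_subset)
  \<comment> \<open>The list index of position \<open>k\<close> is \<open>k - 1\<close>; the
    positions used below satisfy \<open>1 \<le> k\<close>, so the subtraction is exact.\<close>
  have eqk: "interleave n J E F ! (k - 1) = interleave n J E' F' ! (k - 1)" for k using eq by simp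
  have "E ! i = E' ! i" if i: "i < card J" for i
  proof -
    obtain k where k: "k \<in> J" "i = card {j\<in>J. j < k}"
      using bij_betw_imp_surj_on[OF bij_betw_rank[OF fin]] i by blast
    then have "1 \<le> k" "k \<le> n" using J by auto
    then have "Suc (k - 1) = k" "k - 1 < n" by linarith+
    then show ?thesis using eqk[of k] k by (simp add: nth_interleave)
  qed
  moreover have "F ! i = F' ! i" if i: "i < n - card J" for i
  proof -
    obtain k where k: "k \<in> {1..n} - J" "i = card {j\<in>{1..n} - J. j < k}"
      using bij_betw_imp_surj_on[OF bij_betw_rank[of "{1..n} - J"]] i c
      by (metis (no_types, lifting) finite_Diff finite_atLeastAtMost imageE lessThan_iff)
    then have "1 \<le> k" "k \<le> n" by auto
    then have "Suc (k - 1) = k" "k - 1 < n" by linarith+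
    then show ?thesis using eqk[of k] k by (simp add: nth_interleave)
  qed
  ultimately show "E = E' \<and> F = F'" using E F by (auto simp: error_strings_def intro!: nth_equalityI)
qed

text \<open>Surjectivity comes from counting: both sides have \<open>card \<E> ^ n\<close> elements,
  so the injection above is a bijection and no inverse has to be written down.\<close>

lemma sum_interleave:
  fixes f :: "complex mat list \<Rightarrow> 'a::comm_monoid_add"
  assumes J: "J \<subseteq> {1..n}" and fin: "finite \<E>"
  shows "(\<Sum>S\<in>error_strings \<E> n. f S)
    = (\<Sum>E\<in>error_strings \<E> (card J). \<Sum>F\<in>error_strings \<E> (n - card J). f (interleave n J E F))"
proof -
  let ?P = "error_strings \<E> (card J) \<times> error_strings \<E> (n - card J)"
  let ?h = "\<lambda>(E, F). interleave n J E F"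
  have "card J \<le> n" using card_mono[OF _ J] by simp
  then have "card ?P = card (error_strings \<E> n)"
    using fin by (simp add: card_cartesian_product card_error_strings power_add[symmetric])
  moreover have "?h ` ?P \<subseteq> error_strings \<E> n" using interleave_error_strings[OF J] by auto
  ultimately have "?h ` ?P = error_strings \<E> n"
    using fin by (intro card_subset_eq) (simp_all add: card_image[OF inj_on_interleave[OF J]])
  then have "bij_betw ?h ?P (error_strings \<E> n)"
    using inj_on_interleave[OF J] by (simp add: bij_betw_def)
  from sum.reindex_bij_betw[OF this, of f] show ?thesis
    by (simp add: sum.cartesian_product split_def)
qed

section \<open>Traces of interleaved errors\<close>

context error_basis_on
begin

lemma mat_tr_tensor_at_conj:
  assumes J: "J \<subseteq> {1..n}"
    and E: "G \<in> error_strings \<E> (card J)" "E \<in> error_strings \<E> (card J)"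
      "G' \<in> error_strings \<E> (card J)" "E' \<in> error_strings \<E> (card J)"
    and F: "H \<in> error_strings \<E> (n - card J)" "F \<in> error_strings \<E> (n - card J)"
      "H' \<in> error_strings \<E> (n - card J)" "F' \<in> error_strings \<E> (n - card J)"
  shows "mat_tr (mat_adjoint (tensor_at n J G H) * tensor_at n J E F * tensor_at n J G' H' * mat_adjoint (tensor_at n J E' F'))
    = mat_tr (mat_adjoint (tensor_op G) * tensor_op E * tensor_op G' * mat_adjoint (tensor_op E'))
      * (\<Prod>i<n - card J. mat_tr (mat_adjoint (H ! i) * F ! i * H' ! i * mat_adjoint (F' ! i)))"
proof -
  let ?t = "\<lambda>A B C D. mat_tr (mat_adjoint A * B * C * mat_adjoint D)"
  note i = interleave_error_strings[OF J]
  note s = error_strings_set_carrier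
  have len: "length S = k" if "S \<in> error_strings \<E> k" for S k using that by (simp add: error_strings_def)
  have "?t (tensor_at n J G H) (tensor_at n J E F) (tensor_at n J G' H') (tensor_at n J E' F')
    = (\<Prod>k<n. ?t (interleave n J G H ! k) (interleave n J E F ! k) (interleave n J G' H' ! k) (interleave n J E' F' ! k))"
    unfolding tensor_at_def
    by (intro mat_tr_tensor_op_conj[where q = q] s[OF i[OF E(1) F(1)]] s[OF i[OF E(2) F(2)]]
        s[OF i[OF E(3) F(3)]] s[OF i[OF E(4) F(4)]]) auto
  also have "\<dots> = (\<Prod>k<n. if Suc k \<in> J
      then (\<lambda>i. ?t (G ! i) (E ! i) (G' ! i) (E' ! i)) (card {j\<in>J. j < Suc k})
      else (\<lambda>i. ?t (H ! i) (F ! i) (H' ! i) (F' ! i)) (card {j\<in>{1..n} - J. j < Suc k}))"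
    by (intro prod.cong refl) (simp add: nth_interleave)
  also have "\<dots> = (\<Prod>i<card J. ?t (G ! i) (E ! i) (G' ! i) (E' ! i))
      * (\<Prod>i<n - card J. ?t (H ! i) (F ! i) (H' ! i) (F' ! i))"
    by (rule prod_split_rank[OF J])
  \<comment> \<open>The factorisation is read backwards on \<open>J\<close>, since \<Psi> is defined
    by traces of whole tensor products.\<close>
  also have "(\<Prod>i<card J. ?t (G ! i) (E ! i) (G' ! i) (E' ! i))
      = ?t (tensor_op G) (tensor_op E) (tensor_op G') (tensor_op E')"
    by (rule mat_tr_tensor_op_conj[OF len[OF E(1)] len[OF E(2)] len[OF E(3)] len[OF E(4)]
        s[OF E(1)] s[OF E(2)] s[OF E(3)] s[OF E(4)], symmetric])
  finally show ?thesis .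
qed

text \<open>A position where \<open>F\<close> and \<open>F'\<close> differ contributes a zero
  factor. The same \<open>H\<close> stands on both sides of \<open>F\<close> because the two errors
  in an enumerator share their part outside \<open>J\<close>.\<close>

lemma prod_mat_tr_conj_neq:
  assumes "H \<in> error_strings \<E> N" "F \<in> error_strings \<E> N" "F' \<in> error_strings \<E> N" "F \<noteq> F'"
  shows "(\<Prod>i<N. mat_tr (mat_adjoint (H ! i) * F ! i * H ! i * mat_adjoint (F' ! i))) = 0"
proof -
  obtain i where "i < N" "F ! i \<noteq> F' ! i"
    using assms by (auto simp: error_strings_def list_eq_iff_nth_eq)
  moreover have "H ! i \<in> \<E>" "F ! i \<in> \<E>" "F' ! i \<in> \<E>"
    using assms \<open>i < N\<close> by (auto simp: error_strings_def intro!: subsetD[OF _ nth_mem])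
  ultimately have "mat_tr (mat_adjoint (H ! i) * F ! i * H ! i * mat_adjoint (F' ! i)) = 0"
    by (intro mat_tr_conj_neq)
  then show ?thesis using \<open>i < N\<close> by (intro prod_zero) auto
qed

text \<open>Only terms with equal parts outside \<open>J\<close> survive in the double expansion,
  and for these the coefficient is exactly a summand of the enumerator A, times an entry of \<Psi>
  (up to scaling) and a product over the remaining positions.\<close>

lemma mat_tr_tensor_at_expansion:
  assumes J: "J \<subseteq> {1..n}"
    and M: "M1 \<in> carrier_mat (q ^ n) (q ^ n)" "M2 \<in> carrier_mat (q ^ n) (q ^ n)"
    and G: "G \<in> error_strings \<E> (card J)" "G' \<in> error_strings \<E> (card J)"
    and H: "H \<in> error_strings \<E> (n - card J)"
  shows "of_nat q ^ (2 * n) * mat_tr (mat_adjoint (tensor_at n J G H) * M1 * tensor_at n J G' H * M2)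
    = (\<Sum>E\<in>error_strings \<E> (card J). \<Sum>E'\<in>error_strings \<E> (card J). \<Sum>F\<in>error_strings \<E> (n - card J).
        mat_tr (mat_adjoint (tensor_at n J E F) * M1) * mat_tr (tensor_at n J E' F * M2)
        * mat_tr (mat_adjoint (tensor_op G) * tensor_op E * tensor_op G' * mat_adjoint (tensor_op E'))
        * (\<Prod>i<n - card J. mat_tr (mat_adjoint (H ! i) * F ! i * H ! i * mat_adjoint (F ! i))))"
proof -
  let ?m = "error_strings \<E> (card J)" and ?N = "error_strings \<E> (n - card J)"
  let ?a = "\<lambda>E F. mat_tr (mat_adjoint (tensor_at n J E F) * M1)"
  let ?b = "\<lambda>E F. mat_tr (tensor_at n J E F * M2)"
  let ?t = "\<lambda>E E'. mat_tr (mat_adjoint (tensor_op G) * tensor_op E * tensor_op G' * mat_adjoint (tensor_op E'))"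
  let ?p = "\<lambda>F F'. \<Prod>i<n - card J. mat_tr (mat_adjoint (H ! i) * F ! i * H ! i * mat_adjoint (F' ! i))"
  note ts = tensor_op_error_strings[OF interleave_error_strings[OF J]]
  have "of_nat q ^ (2 * n) * mat_tr (mat_adjoint (tensor_at n J G H) * M1 * tensor_at n J G' H * M2)
    = (\<Sum>E\<in>?m. \<Sum>F\<in>?N. \<Sum>E'\<in>?m. \<Sum>F'\<in>?N. ?a E F * ?b E' F' *
        mat_tr (mat_adjoint (tensor_at n J G H) * tensor_at n J E F * tensor_at n J G' H * mat_adjoint (tensor_at n J E' F')))"
    unfolding tensor_at_def mat_tr_expansion[OF M mat_adjoint_carrier[OF ts[OF G(1) H]] ts[OF G(2) H]]
      sum_interleave[OF J finite_error_basis] ..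
  also have "\<dots> = (\<Sum>E\<in>?m. \<Sum>F\<in>?N. \<Sum>E'\<in>?m. \<Sum>F'\<in>?N. if F' = F then ?a E F * ?b E' F * ?t E E' * ?p F F else 0)"
    by (intro sum.cong refl)
      (simp add: mat_tr_tensor_at_conj[OF J G(1) _ G(2) _ H _ H] prod_mat_tr_conj_neq[OF H])
  also have "\<dots> = (\<Sum>E\<in>?m. \<Sum>F\<in>?N. \<Sum>E'\<in>?m. ?a E F * ?b E' F * ?t E E' * ?p F F)"
    by (intro sum.cong refl) (simp add: finite_error_basis)
  also have "\<dots> = (\<Sum>E\<in>?m. \<Sum>E'\<in>?m. \<Sum>F\<in>?N. ?a E F * ?b E' F * ?t E E' * ?p F F)"
    by (intro sum.cong refl sum.swap)
  finally show ?thesis .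
qed

end

section \<open>Homogeneous enumerators\<close>

lemma const_bp_add: "const_bp (a + b) = const_bp a + const_bp b"
  and const_bp_mult: "const_bp (a * b) = const_bp a * const_bp b"
  and const_bp_0 [simp]: "const_bp 0 = 0"
  and const_bp_1 [simp]: "const_bp 1 = 1"
  by (simp_all add: const_bp_def one_pCons)

lemma const_bp_sum: "const_bp (sum f S) = (\<Sum>x\<in>S. const_bp (f x))"
  by (induction S rule: infinite_finite_induct) (simp_all add: const_bp_add)

lemma const_bp_prod: "const_bp (prod f S) = (\<Prod>x\<in>S. const_bp (f x))"
  by (induction S rule: infinite_finite_induct) (simp_all add: const_bp_mult)

lemma const_bp_power: "const_bp (a ^ k) = const_bp a ^ k"
  by (induction k) (simp_all add: const_bp_mult)

lemma hom_poly_0 [simp]: "hom_poly N w z 0 = 0"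
  by (simp add: hom_poly_def)

lemma hom_poly_add: "hom_poly N w z (p + p') = hom_poly N w z p + hom_poly N w z p'"
  by (simp add: hom_poly_def const_bp_add algebra_simps sum.distrib)

lemma hom_poly_monom: "d \<le> N \<Longrightarrow> hom_poly N w z (monom c d) = const_bp c * w ^ (N - d) * z ^ d"
  by (simp add: hom_poly_def if_distrib[of const_bp] if_distrib[of "\<lambda>x. x * _"] cong: if_cong)

lemma lookup_hom_tens: "Poly_Mapping.lookup (hom_tens N w z v) k = hom_poly N w z (Poly_Mapping.lookup v k)"
  unfolding hom_tens_def by transfer (simp add: when_def)

lemma hom_tens_0 [simp]: "hom_tens N w z 0 = 0"
  by (rule poly_mapping_eqI) (simp add: lookup_hom_tens)

lemma hom_tens_add: "hom_tens N w z (u + v) = hom_tens N w z u + hom_tens N w z v"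
  by (rule poly_mapping_eqI) (simp add: lookup_hom_tens lookup_add hom_poly_add)

lemma hom_tens_sum: "hom_tens N w z (sum f S) = (\<Sum>x\<in>S. hom_tens N w z (f x))"
  by (induction S rule: infinite_finite_induct) (simp_all add: hom_tens_add)

lemma hom_tens_scale_basis:
  "hom_tens N w z (scale_tens p (basis_tens E E')) = scale_tens (hom_poly N w z p) (basis_tens E E')"
  by (rule poly_mapping_eqI)
    (simp add: lookup_hom_tens lookup_scale_tens basis_tens_eq_single lookup_single when_def)

lemma Psi_0 [simp]: "Psi q \<E> m 0 = 0"
  by (simp add: Psi_def)

lemma Psi_sum: "Psi q \<E> m (sum f S) = (\<Sum>x\<in>S. Psi q \<E> m (f x))"
  by (induction S rule: infinite_finite_induct) (simp_all add: Psi_add)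

lemma scale_tens_sum_left: "scale_tens (sum f S) v = (\<Sum>x\<in>S. scale_tens (f x) v)"
  by (induction S rule: infinite_finite_induct) (simp_all add: scale_tens_add_left)

text \<open>This bound supplies the degree condition of \<open>hom_poly_monom\<close>, so
  homogenising loses no term.\<close>

lemma wt_error_strings: "Es \<in> error_strings \<E> N \<Longrightarrow> wt q Es \<le> N"
  unfolding wt_def error_strings_def
  using card_mono[of "{..<length Es}" "{i. i < length Es \<and> Es ! i \<noteq> 1\<^sub>m q}"] by auto

lemma sum_swap_last:
  fixes f :: "'a \<Rightarrow> 'b \<Rightarrow> 'c \<Rightarrow> 'd \<Rightarrow> 'e::comm_monoid_add"
  shows "(\<Sum>a\<in>A. \<Sum>b\<in>B. \<Sum>c\<in>C. \<Sum>d\<in>D. f a b c d) = (\<Sum>d\<in>D. \<Sum>a\<in>A. \<Sum>b\<in>B. \<Sum>c\<in>C. f a b c d)"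
proof -
  have "(\<Sum>a\<in>A. \<Sum>b\<in>B. \<Sum>c\<in>C. \<Sum>d\<in>D. f a b c d) = (\<Sum>a\<in>A. \<Sum>b\<in>B. \<Sum>d\<in>D. \<Sum>c\<in>C. f a b c d)"
    by (intro sum.cong refl sum.swap)
  also have "\<dots> = (\<Sum>a\<in>A. \<Sum>d\<in>D. \<Sum>b\<in>B. \<Sum>c\<in>C. f a b c d)" by (intro sum.cong refl sum.swap)
  also have "\<dots> = (\<Sum>d\<in>D. \<Sum>a\<in>A. \<Sum>b\<in>B. \<Sum>c\<in>C. f a b c d)" by (rule sum.swap)
  finally show ?thesis .
qed

text \<open>As a product over positions, the weight monomial can be absorbed into the one-position
  factors, and the sum over strings then factorises.\<close>

lemma prod_weight:
  fixes w z :: "'a::comm_monoid_mult"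
  shows "(\<Prod>i<length Es. if Es ! i = 1\<^sub>m q then w else z) = w ^ (length Es - wt q Es) * z ^ wt q Es"
proof -
  let ?A = "{i. i < length Es \<and> Es ! i \<noteq> 1\<^sub>m q}"
  have eq: "{..<length Es} \<inter> {i. Es ! i = 1\<^sub>m q} = {..<length Es} - ?A"
    "{..<length Es} \<inter> - {i. Es ! i = 1\<^sub>m q} = ?A" by auto
  have "card ({..<length Es} - ?A) = length Es - wt q Es"
    unfolding wt_def by (subst card_Diff_subset) auto
  then show ?thesis by (simp add: prod.If_cases eq wt_def)
qed

section \<open>Weighted sums and the substitution of variables\<close>

context error_basis_on
begin

text \<open>The term \<open>H = I\<close> contributes \<open>q * w\<close>, the others
  \<open>z\<close> times the complete sum less \<open>q\<close>. The factor \<open>q ^ 2\<close> is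
  split off to expose the substituted variables; over all positions outside \<open>J\<close> it
  cancels part of the normalisation \<open>q ^ (2 * n)\<close>.\<close>

lemma sum_weighted_conj:
  assumes F: "F \<in> \<E>"
  shows "(\<Sum>H\<in>\<E>. const_bp (mat_tr (mat_adjoint H * F * H * mat_adjoint F)) * (if H = 1\<^sub>m q then w else z))
    = const_bp (of_nat q ^ 2) *
      (if F = 1\<^sub>m q then const_bp (1 / of_nat q) * (w + const_bp (of_nat q ^ 2 - 1) * z)
       else const_bp (1 / of_nat q) * (w - z))"
proof -
  let ?c = "\<lambda>H. mat_tr (mat_adjoint H * F * H * mat_adjoint F)"
  have c: "F \<in> carrier_mat q q" using F error_basis_carrier by auto
  have F1: "?c (1\<^sub>m q) = of_nat q"
    using mat_tr_error_basis[OF F F] mat_tr_mult_comm[OF mat_adjoint_carrier[OF c] c]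
    by (simp add: mat_adjoint_one left_mult_one_mat[OF c] right_mult_one_mat[OF c])
  have rest: "(\<Sum>H\<in>\<E> - {1\<^sub>m q}. ?c H) = (if F = 1\<^sub>m q then of_nat q ^ 3 else 0) - of_nat q"
    using sum_mat_tr_conj[OF F] F1 sum.remove[OF finite_error_basis one_in_error_basis, of ?c]
    by (simp add: algebra_simps)
  have q: "(of_nat q :: complex) \<noteq> 0" using error_basis_dim_pos by simp
  have "(\<Sum>H\<in>\<E>. const_bp (?c H) * (if H = 1\<^sub>m q then w else z))
    = const_bp (of_nat q) * w + (\<Sum>H\<in>\<E> - {1\<^sub>m q}. const_bp (?c H) * z)"
    by (subst sum.remove[OF finite_error_basis one_in_error_basis]) (simp add: F1)
  also have "\<dots> = const_bp (of_nat q) * w + const_bp ((if F = 1\<^sub>m q then of_nat q ^ 3 else 0) - of_nat q) * z"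
    by (simp only: sum_distrib_right[symmetric] const_bp_sum[symmetric] rest)
  also have "\<dots> = const_bp (of_nat q ^ 2) *
      (if F = 1\<^sub>m q then const_bp (1 / of_nat q) * (w + const_bp (of_nat q ^ 2 - 1) * z)
       else const_bp (1 / of_nat q) * (w - z))"
  proof -
    have 1: "const_bp (of_nat q ^ 2) * (const_bp (1 / of_nat q) * x) = const_bp (of_nat q) * x" for x
      using q by (simp add: mult.assoc[symmetric] const_bp_mult[symmetric] power2_eq_square)
    have 2: "of_nat q ^ 3 - of_nat q = (of_nat q * (of_nat q ^ 2 - 1) :: complex)"
      by (simp add: power2_eq_square power3_eq_cube algebra_simps)
    have 3: "const_bp (- of_nat q) = - const_bp (of_nat q)" by (simp add: const_bp_def)
    show ?thesis
    proof (cases "F = 1\<^sub>m q")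
      case True
      have "const_bp (of_nat q ^ 3 - of_nat q) = const_bp (of_nat q) * const_bp (of_nat q ^ 2 - 1)"
        unfolding 2 const_bp_mult ..
      then show ?thesis by (simp only: True simp_thms if_True 1) (simp only: distrib_left mult.assoc)
    next
      case False
      then show ?thesis by (simp add: 1 3 right_diff_distrib)
    qed
  qed
  finally show ?thesis .
qed

lemma sum_weighted_conj_strings:
  assumes F: "F \<in> error_strings \<E> N"
  shows "(\<Sum>H\<in>error_strings \<E> N. const_bp (\<Prod>i<N. mat_tr (mat_adjoint (H ! i) * F ! i * H ! i * mat_adjoint (F ! i)))
      * (w ^ (N - wt q H) * z ^ wt q H))
    = const_bp (of_nat q ^ (2 * N)) *
      ((const_bp (1 / of_nat q) * (w + const_bp (of_nat q ^ 2 - 1) * z)) ^ (N - wt q F)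
       * (const_bp (1 / of_nat q) * (w - z)) ^ wt q F)"
proof -
  let ?W = "const_bp (1 / of_nat q) * (w + const_bp (of_nat q ^ 2 - 1) * z)"
  let ?Z = "const_bp (1 / of_nat q) * (w - z)"
  let ?c = "\<lambda>F H. mat_tr (mat_adjoint H * F * H * mat_adjoint F)"
  have wt: "(\<Prod>i<N. if H ! i = 1\<^sub>m q then x else y) = x ^ (N - wt q H) * y ^ wt q H"
    if "H \<in> error_strings \<E> N" for H and x y :: bipoly
    using prod_weight[of H q x y] that by (auto simp: error_strings_def)
  have FE: "F ! i \<in> \<E>" if "i < N" for i using F that by (auto simp: error_strings_def)
  have "(\<Sum>H\<in>error_strings \<E> N. const_bp (\<Prod>i<N. ?c (F ! i) (H ! i)) * (w ^ (N - wt q H) * z ^ wt q H))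
    = (\<Sum>H\<in>error_strings \<E> N. \<Prod>i<N. const_bp (?c (F ! i) (H ! i)) * (if H ! i = 1\<^sub>m q then w else z))"
    by (intro sum.cong refl) (simp add: wt const_bp_prod prod.distrib)
  also have "\<dots> = (\<Prod>i<N. \<Sum>H\<in>\<E>. const_bp (?c (F ! i) H) * (if H = 1\<^sub>m q then w else z))"
    by (rule sum_prod_error_strings)
  also have "\<dots> = (\<Prod>i<N. const_bp (of_nat q ^ 2) * (if F ! i = 1\<^sub>m q then ?W else ?Z))"
    by (intro prod.cong refl sum_weighted_conj FE) simp
  also have "\<dots> = const_bp (of_nat q ^ (2 * N)) * (?W ^ (N - wt q F) * ?Z ^ wt q F)"
    by (simp add: prod.distrib wt[OF F] power_mult const_bp_power)
  finally show ?thesis .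
qed

lemma hom_enum_A_eq:
  "hom_enum_A q \<E> n J w z M1 M2 = (\<Sum>E\<in>error_strings \<E> (card J). \<Sum>E'\<in>error_strings \<E> (card J).
    \<Sum>F\<in>error_strings \<E> (n - card J). scale_tens
      (const_bp (mat_tr (mat_adjoint (tensor_at n J E F) * M1) * mat_tr (tensor_at n J E' F * M2))
        * w ^ (n - card J - wt q F) * z ^ wt q F) (basis_tens E E'))"
  unfolding hom_enum_A_def enum_A_def hom_tens_sum hom_tens_scale_basis
  by (intro sum.cong refl, subst hom_poly_monom)
    (simp_all add: wt_error_strings)

lemma hom_enum_B_eq:
  "hom_enum_B q \<E> n J w z M1 M2 = (\<Sum>E\<in>error_strings \<E> (card J). \<Sum>E'\<in>error_strings \<E> (card J).
    \<Sum>F\<in>error_strings \<E> (n - card J). scale_tens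
      (const_bp (mat_tr (mat_adjoint (tensor_at n J E F) * M1 * tensor_at n J E' F * M2))
        * w ^ (n - card J - wt q F) * z ^ wt q F) (basis_tens E E'))"
  unfolding hom_enum_B_def enum_B_def hom_tens_sum hom_tens_scale_basis
  by (intro sum.cong refl, subst hom_poly_monom)
    (simp_all add: wt_error_strings)

text \<open>This compares the coefficients of one basis tensor, for \<open>G\<close> and
  \<open>G'\<close>, on the two sides of the theorem. After expansion, \<open>H\<close> occurs only
  in the product over positions outside \<open>J\<close> and in its own weight monomial, so the sum
  over \<open>H\<close> can be carried out for each fixed \<open>F\<close>.\<close>

lemma hom_enum_coeff_transform:
  fixes w z :: bipoly
  assumes J: "J \<subseteq> {1..n}"
    and M: "M1 \<in> carrier_mat (q ^ n) (q ^ n)" "M2 \<in> carrier_mat (q ^ n) (q ^ n)"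
    and G: "G \<in> error_strings \<E> (card J)" "G' \<in> error_strings \<E> (card J)"
  defines "W \<equiv> const_bp (1 / of_nat q) * (w + const_bp (of_nat q ^ 2 - 1) * z)"
    and "Z \<equiv> const_bp (1 / of_nat q) * (w - z)"
  shows "(\<Sum>H\<in>error_strings \<E> (n - card J).
      const_bp (mat_tr (mat_adjoint (tensor_at n J G H) * M1 * tensor_at n J G' H * M2))
        * w ^ (n - card J - wt q H) * z ^ wt q H)
    = (\<Sum>E\<in>error_strings \<E> (card J). \<Sum>E'\<in>error_strings \<E> (card J). \<Sum>F\<in>error_strings \<E> (n - card J).
      const_bp (mat_tr (mat_adjoint (tensor_at n J E F) * M1) * mat_tr (tensor_at n J E' F * M2))
        * W ^ (n - card J - wt q F) * Z ^ wt q F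
        * (const_bp (1 / of_nat q ^ (2 * card J))
        * const_bp (mat_tr (mat_adjoint (tensor_op G) * tensor_op E * tensor_op G' * mat_adjoint (tensor_op E')))))"
proof -
  define m where "m = card J"
  define N where "N = n - card J"
  have n: "n = m + N" using card_mono[OF _ J] by (simp add: m_def N_def)
  let ?m = "error_strings \<E> m" and ?N = "error_strings \<E> N"
  let ?ab = "\<lambda>E E' F. mat_tr (mat_adjoint (tensor_at n J E F) * M1) * mat_tr (tensor_at n J E' F * M2)"
  let ?t = "\<lambda>E E'. mat_tr (mat_adjoint (tensor_op G) * tensor_op E * tensor_op G' * mat_adjoint (tensor_op E'))"
  let ?p = "\<lambda>F H. \<Prod>i<N. mat_tr (mat_adjoint (H ! i) * F ! i * H ! i * mat_adjoint (F ! i))"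
  let ?r = "1 / of_nat q ^ (2 * n) :: complex"
  let ?x = "\<lambda>H. w ^ (N - wt q H) * z ^ wt q H"
  have q: "(of_nat q :: complex) \<noteq> 0" using error_basis_dim_pos by simp
  have \<beta>: "mat_tr (mat_adjoint (tensor_at n J G H) * M1 * tensor_at n J G' H * M2)
      = (\<Sum>E\<in>?m. \<Sum>E'\<in>?m. \<Sum>F\<in>?N. ?r * (?ab E E' F * ?t E E' * ?p F H))" if "H \<in> ?N" for H
  proof -
    have div: "x = ?r * s" if "of_nat q ^ (2 * n) * x = s" for x s using that[symmetric] q by simp
    show ?thesis
      using div[OF mat_tr_tensor_at_expansion[OF J M G, of H]] that
      by (simp only: m_def N_def sum_distrib_left)
  qed
  have "(\<Sum>H\<in>?N. const_bp (mat_tr (mat_adjoint (tensor_at n J G H) * M1 * tensor_at n J G' H * M2))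
        * w ^ (N - wt q H) * z ^ wt q H)
    = (\<Sum>H\<in>?N. \<Sum>E\<in>?m. \<Sum>E'\<in>?m. \<Sum>F\<in>?N. const_bp (?r * (?ab E E' F * ?t E E' * ?p F H)) * ?x H)"
    by (intro sum.cong refl) (simp only: \<beta> const_bp_sum sum_distrib_right mult.assoc)
  \<comment> \<open>Three exchanges move the sum over \<open>H\<close> to the innermost
    place.\<close>
  also have "\<dots> = (\<Sum>E\<in>?m. \<Sum>H\<in>?N. \<Sum>E'\<in>?m. \<Sum>F\<in>?N. const_bp (?r * (?ab E E' F * ?t E E' * ?p F H)) * ?x H)"
    by (rule sum.swap)
  also have "\<dots> = (\<Sum>E\<in>?m. \<Sum>E'\<in>?m. \<Sum>H\<in>?N. \<Sum>F\<in>?N. const_bp (?r * (?ab E E' F * ?t E E' * ?p F H)) * ?x H)"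
    by (intro sum.cong refl sum.swap)
  also have "\<dots> = (\<Sum>E\<in>?m. \<Sum>E'\<in>?m. \<Sum>F\<in>?N. \<Sum>H\<in>?N. const_bp (?r * (?ab E E' F * ?t E E' * ?p F H)) * ?x H)"
    by (intro sum.cong refl sum.swap)
  also have "\<dots> = (\<Sum>E\<in>?m. \<Sum>E'\<in>?m. \<Sum>F\<in>?N. const_bp (?ab E E' F) * W ^ (N - wt q F) * Z ^ wt q F
        * (const_bp (1 / of_nat q ^ (2 * m)) * const_bp (?t E E')))"
  proof (intro sum.cong refl)
    fix E E' F assume F: "F \<in> ?N"
    have "(\<Sum>H\<in>?N. const_bp (?r * (?ab E E' F * ?t E E' * ?p F H)) * ?x H)
      = const_bp (?r * (?ab E E' F * ?t E E')) * (\<Sum>H\<in>?N. const_bp (?p F H) * ?x H)"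
      by (simp only: sum_distrib_left const_bp_mult mult.assoc)
    also have "\<dots> = const_bp (?r * (?ab E E' F * ?t E E') * of_nat q ^ (2 * N)) * (W ^ (N - wt q F) * Z ^ wt q F)"
      unfolding sum_weighted_conj_strings[OF F] W_def Z_def by (simp only: const_bp_mult mult.assoc)
    \<comment> \<open>Of the normalisation \<open>q ^ (2 * n)\<close>, the \<open>N = n - m\<close>
      positions outside \<open>J\<close> cancel \<open>q ^ (2 * N)\<close>; what is left is the
      factor \<open>1 / q ^ (2 * m)\<close> of \<Psi>.\<close>
    also have "?r * (?ab E E' F * ?t E E') * of_nat q ^ (2 * N) = ?ab E E' F * (1 / of_nat q ^ (2 * m) * ?t E E')"
      using q by (simp add: n power_add distrib_left)
    finally show "(\<Sum>H\<in>?N. const_bp (?r * (?ab E E' F * ?t E E' * ?p F H)) * ?x H)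
      = const_bp (?ab E E' F) * W ^ (N - wt q F) * Z ^ wt q F * (const_bp (1 / of_nat q ^ (2 * m)) * const_bp (?t E E'))"
      by (simp only: const_bp_mult ac_simps)
  qed
  finally show ?thesis by (simp only: m_def N_def)
qed

end

section \<open>The transform of the tensor enumerators\<close>

theorem theoremV2:
  fixes q n m :: nat and \<E> :: "complex mat set" and M1 M2 :: "complex mat" and J :: "nat set"
  assumes "error_basis q \<E>"
    and "hermitian_mat (q ^ n) M1"
    and "hermitian_mat (q ^ n) M2"
    and "J \<subseteq> {1..n}"
    and "card J = m"
  shows "hom_enum_B q \<E> n J var_w var_z M1 M2 =
    Psi q \<E> m
      (hom_enum_A q \<E> n J
        (const_bp (1 / of_nat q) * (var_w + const_bp (of_nat q ^ 2 - 1) * var_z))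
        (const_bp (1 / of_nat q) * (var_w - var_z)) M1 M2)"
proof -
  interpret error_basis_on q \<E> by unfold_locales (rule assms(1))
  have M: "M1 \<in> carrier_mat (q ^ n) (q ^ n)" "M2 \<in> carrier_mat (q ^ n) (q ^ n)"
    using assms(2,3) by (auto simp: hermitian_mat_def)
  let ?m = "error_strings \<E> m" and ?N = "error_strings \<E> (n - m)"
  let ?a = "\<lambda>E E' F. const_bp (mat_tr (mat_adjoint (tensor_at n J E F) * M1) * mat_tr (tensor_at n J E' F * M2))
    * (const_bp (1 / of_nat q) * (var_w + const_bp (of_nat q ^ 2 - 1) * var_z)) ^ (n - m - wt q F)
    * (const_bp (1 / of_nat q) * (var_w - var_z)) ^ wt q F"
  let ?k = "\<lambda>E E' G G'. const_bp (1 / of_nat q ^ (2 * m))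
    * const_bp (mat_tr (mat_adjoint (tensor_op G) * tensor_op E * tensor_op G' * mat_adjoint (tensor_op E')))"
  let ?s = "\<lambda>E E' F G G'. scale_tens (?a E E' F * ?k E E' G G') (basis_tens G G')"
  have "Psi q \<E> m
      (hom_enum_A q \<E> n J
        (const_bp (1 / of_nat q) * (var_w + const_bp (of_nat q ^ 2 - 1) * var_z))
        (const_bp (1 / of_nat q) * (var_w - var_z)) M1 M2)
    = (\<Sum>E\<in>?m. \<Sum>E'\<in>?m. \<Sum>F\<in>?N. \<Sum>G\<in>?m. \<Sum>G'\<in>?m. ?s E E' F G G')"
    unfolding hom_enum_A_eq Psi_sum Psi_scale assms(5)
    by (intro sum.cong refl)
      (simp only: Psi_basis_tens Psi_basis_def scale_tens_sum scale_tens_scale_tens mult.assoc)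
  \<comment> \<open>The sums over \<open>G\<close> and \<open>G'\<close>, which come from \<Psi>,
    are moved outside to collect the coefficient of each basis tensor.\<close>
  also have "\<dots> = (\<Sum>G\<in>?m. \<Sum>E\<in>?m. \<Sum>E'\<in>?m. \<Sum>F\<in>?N. \<Sum>G'\<in>?m. ?s E E' F G G')"
    by (rule sum_swap_last)
  also have "\<dots> = (\<Sum>G\<in>?m. \<Sum>G'\<in>?m. \<Sum>E\<in>?m. \<Sum>E'\<in>?m. \<Sum>F\<in>?N. ?s E E' F G G')"
    by (intro sum.cong refl sum_swap_last)
  also have "\<dots> = (\<Sum>G\<in>?m. \<Sum>G'\<in>?m.
      scale_tens (\<Sum>E\<in>?m. \<Sum>E'\<in>?m. \<Sum>F\<in>?N. ?a E E' F * ?k E E' G G') (basis_tens G G'))"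
    by (simp only: scale_tens_sum_left)
  \<comment> \<open>The coefficient identity is applied from right to left, with the two variables
    for \<open>w\<close> and \<open>z\<close>.\<close>
  also have "\<dots> = (\<Sum>G\<in>?m. \<Sum>G'\<in>?m. scale_tens (\<Sum>H\<in>?N.
      const_bp (mat_tr (mat_adjoint (tensor_at n J G H) * M1 * tensor_at n J G' H * M2))
        * var_w ^ (n - m - wt q H) * var_z ^ wt q H) (basis_tens G G'))"
    by (intro sum.cong refl arg_cong2[of _ _ _ _ scale_tens]
        hom_enum_coeff_transform[OF assms(4) M, unfolded assms(5), symmetric])
  also have "\<dots> = hom_enum_B q \<E> n J var_w var_z M1 M2"
    unfolding hom_enum_B_eq assms(5) scale_tens_sum_left ..
  finally show ?thesis ..
qed

end
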